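(* Let $p\in(0,1)$ be fixed (independent of $n$). For almost all graphs $G$ in the Erdős–Rényi model $G_{n,p}$, the energies of the Zagreb matrices $M_1(G)$ and $M_2(G)$ satisfy $$\mathscr{E}(M_1(G))=(1+o(1))\,p\cdot\frac{16}{3\pi}\sqrt{p(1-p)}\cdot n^{5/2},$$ $$\mathscr{E}(M_2(G))=(1+o(1))\,p^2\cdot\frac{8}{3\pi}\sqrt{p(1-p)}\cdot n^{7/2}.$$
   Context: $G_{n,p}$ is the model of random simple graphs on vertex set $\{1,\dots,n\}$ in which each edge is present independently with probability $p$; $d_i$ is the degree of vertex $i$ in $G=(V,E)$. $M_1(G)$ is the $n\times n$ matrix with $(i,j)$-entry $d_i+d_j$ if $ij\in E$ and $0$ otherwise. $M_2(G)$ is the $n\times n$ matrix with $(i,j)$-entry $d_id_j$ if $ij\in E$ and $0$ otherwise. The energy of a real symmetric matrix $A$ with eigenvalues $\lambda_1,\dots,\lambda_n$ is $\mathscr{E}(A)=\sum_{i=1}^n|\lambda_i|$. "Almost all" means with probability tending to $1$ as $n\to\infty$; thus "for almost all graphs, $\mathscr{E}=(1+o(1))g(n)$" means that for every $\varepsilon>0$, $\Pr(|\mathscr{E}/g(n)-1|>\varepsilon)\to0$ as $n\to\infty$. *)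

theory Defs
  imports
    "HOL-Probability.Product_PMF"
    "Jordan_Normal_Form.Char_Poly"
begin

text \<open>
  A simple graph on the vertex set \<open>{1..n}\<close> is represented by its edge set, a set of
  two-element subsets of \<open>{1..n}\<close>.
\<close>

definition all_edges :: "nat \<Rightarrow> nat set set" where
  "all_edges n = {e. e \<subseteq> {1..n} \<and> card e = 2}"

definition Gnp :: "nat \<Rightarrow> real \<Rightarrow> nat set set pmf" where
  "Gnp n p = map_pmf (\<lambda>f. {e \<in> all_edges n. f e})
     (Pi_pmf (all_edges n) False (\<lambda>_. bernoulli_pmf p))"

definition deg :: "nat set set \<Rightarrow> nat \<Rightarrow> nat" where
  "deg E v = card {e \<in> E. v \<in> e}"

text \<open>
  Matrix indices start at 0, so row and column \<open>i\<close> belong to the vertex \<open>i + 1\<close>.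
\<close>

definition zagreb1 :: "nat \<Rightarrow> nat set set \<Rightarrow> real mat" where
  "zagreb1 n E = Matrix.mat n n (\<lambda>(i, j).
     if {i + 1, j + 1} \<in> E then real (deg E (i + 1)) + real (deg E (j + 1)) else 0)"

definition zagreb2 :: "nat \<Rightarrow> nat set set \<Rightarrow> real mat" where
  "zagreb2 n E = Matrix.mat n n (\<lambda>(i, j).
     if {i + 1, j + 1} \<in> E then real (deg E (i + 1)) * real (deg E (j + 1)) else 0)"

text \<open>
  Each eigenvalue counts with its multiplicity as a root of the characteristic polynomial.
  This is meant for symmetric \<open>A\<close> only: then all \<open>n\<close> complex eigenvalues are real, so the
  sum has \<open>n\<close> terms.
\<close>

definition energy :: "real mat \<Rightarrow> real" where
  "energy A = (\<Sum>x | eigenvalue A x. real (order x (char_poly A)) * \<bar>x\<bar>)"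

lemma energy_eq_sum_list:
  assumes A: "A \<in> carrier_mat n n"
    and cp: "char_poly A = (\<Prod>x\<leftarrow>es. [:- x, 1:])"
  shows "energy A = (\<Sum>x\<leftarrow>es. \<bar>x\<bar>)"
proof -
  have "{x. eigenvalue A x} = set es"
    using cp by (auto simp: eigenvalue_root_char_poly[OF A] poly_prod_list prod_list_zero_iff)
  moreover have "order x (\<Prod>y\<leftarrow>es. [:- y, 1:]) = count (mset es) x" for x :: real
  proof (induction es)
    case (Cons y es)
    have "(\<Prod>y\<leftarrow>es. [:- y, 1:]) \<noteq> 0"
      by (auto simp: prod_list_zero_iff)
    hence "[:- y, 1:] * (\<Prod>y\<leftarrow>es. [:- y, 1:]) \<noteq> 0"
      by (metis mult_eq_0_iff one_neq_zero pCons_eq_0_iff)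
    moreover have "order x [:- y, 1:] = (if x = y then 1 else 0)"
      using order_power_n_n[of y 1] by (auto intro!: order_0I)
    ultimately show ?case
      using Cons.IH by (simp add: order_mult del: mult_pCons_left)
  qed (auto intro: order_0I)
  ultimately have "energy A = (\<Sum>x\<in>set es. real (count (mset es) x) * \<bar>x\<bar>)"
    by (simp add: energy_def cp)
  also have "\<dots> = (\<Sum>x\<leftarrow>es. \<bar>x\<bar>)"
  proof -
    have "(\<Sum>x\<in>B. real (count (mset xs) x) * \<bar>x\<bar>) = (\<Sum>x\<leftarrow>xs. \<bar>x\<bar>)"
      if "finite B" "set xs \<subseteq> B" for B and xs :: "real list"
      using that(2)
    proof (induction xs)
      case (Cons y ys)
      have "(\<Sum>x\<in>B. real (count (mset (y # ys)) x) * \<bar>x\<bar>) =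
            (\<Sum>x\<in>B. (if x = y then \<bar>x\<bar> else 0) + real (count (mset ys) x) * \<bar>x\<bar>)"
        by (intro sum.cong) (auto simp: algebra_simps)
      also have "\<dots> = (\<Sum>x\<leftarrow>y # ys. \<bar>x\<bar>)"
        using Cons that(1) by (simp add: sum.distrib)
      finally show ?case .
    qed simp
    thus ?thesis by blast
  qed
  finally show ?thesis .
qed

end

theory Submission
  imports Defs "HOL-Real_Asymp.Real_Asymp"
begin

text \<open>
  Up to small errors both Zagreb matrices are multiples of the adjacency matrix: degrees concentrate
  around \<open>n p\<close>, so an edge \<open>i j\<close> carries weight about \<open>2 n p\<close> in the first matrix and about
  \<open>n\<^sup>2 p\<^sup>2\<close> in the second. The energy of a symmetric matrix is its trace norm. By duality against the
  sign of the matrix, it changes by at most \<open>sqrt n\<close> times the Frobenius norm of a perturbation, and by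
  at most \<open>\<bar>d\<bar> n\<close> when the constant \<open>d\<close> is added to every entry (\<open>kernel_energy_perturbation\<close>). Degree
  fluctuations have variance at most \<open>n\<close>, so replacing the weights by their typical value costs a
  factor \<open>sqrt n\<close> less than the main term; subtracting the mean \<open>p\<close> costs no more than that. What
  remains is the energy of the centred adjacency matrix \<open>X\<close>, normalised so that its entries have
  variance \<open>1 / n\<close>; it is called \<open>wigner\<close> below.

  The energy of \<open>X\<close>, divided by \<open>n\<close>, tends to the first absolute moment \<open>8 / (3 \<pi>)\<close> of the
  semicircle law. The proof goes through the resolvent \<open>G\<close> at the imaginary point \<open>i t\<close>, where all
  entries are bounded by \<open>1 / t\<close>, and its normalised trace \<open>s\<close>.

  \<^item> A centred Bernoulli variable satisfies an exact integration by parts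
  (\<open>expectation_centered_bernoulli_mult\<close>). Applied to the diagonal of \<open>X G = i t G + 1\<close>, it
  turns each summand \<open>E (X\<^sub>i\<^sub>j G\<^sub>i\<^sub>j)\<close> into a difference of resolvents at two graphs which differ in one
  edge, and the resolvent identity evaluates this as \<open>- E (G\<^sub>i\<^sub>i G\<^sub>j\<^sub>j + G\<^sub>i\<^sub>j\<^sup>2) / n\<close> up to \<open>O (n powr (-3/2))\<close>.
  Summation gives \<open>i t E s + 1 + E (s\<^sup>2) \<approx> 0\<close> (\<open>mean_s_squared\<close>).

  \<^item> Flipping one edge changes \<open>s\<close> by \<open>O (n powr (-3/2))\<close>, and there are at most \<open>n\<^sup>2\<close> edges; the Efron-Stein
  inequality gives \<open>Var s = O (1 / n)\<close> (\<open>variance_s\<close>). Hence \<open>m = E s\<close> almost solves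
  \<open>i t m + 1 + m\<^sup>2 = 0\<close>. That equation is stable in the upper half plane and its root there is the value
  at \<open>i t\<close> of the Stieltjes transform of the semicircle law (\<open>mean_close\<close>).

  \<^item> Absolute values are recovered from \<open>s\<close> by
  \<open>(\<pi> / 2) \<bar>x\<bar> = \<integral> x\<^sup>2 / (x\<^sup>2 + t\<^sup>2) dt\<close> over \<open>t > 0\<close>, since averaging the integrand over the spectrum
  gives \<open>1 - t Im s\<close>. The parts of the integral near \<open>0\<close> and near infinity are uniformly small, and the
  limit has the primitive \<open>semicircle_primitive\<close>, which increases by \<open>4 / 3\<close> in total
  (\<open>expected_energy_limit\<close>).

  All errors are controlled in expectation, so Markov's inequality concludes.
\<close>

section \<open>Diagonalisation of real symmetric matrices\<close>

text \<open>
  The characteristic polynomial has a complex root \<open>z\<close>. Let \<open>x + i y\<close> be an eigenvector for it. Pairing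
  the equation for \<open>A x\<close> with \<open>y\<close> and the one for \<open>A y\<close> with \<open>x\<close> gives the same number by symmetry, which
  forces \<open>Im z (\<bar>x\<bar>\<^sup>2 + \<bar>y\<bar>\<^sup>2) = 0\<close>. So \<open>z\<close> is real, and \<open>x\<close> or \<open>y\<close> is a real eigenvector.
\<close>

lemma symmetric_mat_real_eigenvector:
  fixes A :: "real mat"
  assumes A: "A \<in> carrier_mat n n" and sym: "A\<^sup>T = A" and n: "0 < n"
  shows "\<exists>e v. v \<in> carrier_vec n \<and> scalar_prod v v = 1 \<and> A *\<^sub>v v = e \<cdot>\<^sub>v v"
proof -
  let ?C = "map_mat complex_of_real A"
  have C: "?C \<in> carrier_mat n n" using A by simp
  have "degree (char_poly ?C) = n"
    using degree_monic_char_poly[OF C] by simp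
  hence "\<not> constant (poly (char_poly ?C))"
    using n by (simp add: constant_degree)
  then obtain z where "poly (char_poly ?C) z = 0"
    using fundamental_theorem_of_algebra by blast
  then obtain v where v: "v \<in> carrier_vec n" "v \<noteq> 0\<^sub>v n" "?C *\<^sub>v v = z \<cdot>\<^sub>v v"
    using eigenvalue_root_char_poly[OF C] A by (auto simp: eigenvalue_def eigenvector_def)
  define x y where "x i = Re (v $ i)" and "y i = Im (v $ i)" for i
  have Av: "(\<Sum>j<n. of_real (A $$ (i, j)) * v $ j) = z * v $ i" if "i < n" for i
  proof -
    have "(?C *\<^sub>v v) $ i = (\<Sum>j<n. of_real (A $$ (i, j)) * v $ j)"
      using that A v(1) by (auto simp: scalar_prod_def atLeast0LessThan intro!: sum.cong)
    thus ?thesis using v(1,3) that by simp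
  qed
  have Ax: "(\<Sum>j<n. A $$ (i, j) * x j) = Re z * x i - Im z * y i" if "i < n" for i
    using arg_cong[OF Av[OF that], of Re] by (simp add: x_def y_def)
  have Ay: "(\<Sum>j<n. A $$ (i, j) * y j) = Re z * y i + Im z * x i" if "i < n" for i
    using arg_cong[OF Av[OF that], of Im] by (simp add: x_def y_def)
  have Asym: "A $$ (i, j) = A $$ (j, i)" if "i < n" "j < n" for i j
    using that A sym by (metis carrier_matD index_transpose_mat(1))
  have "(\<Sum>i<n. y i * (\<Sum>j<n. A $$ (i, j) * x j)) = (\<Sum>i<n. x i * (\<Sum>j<n. A $$ (i, j) * y j))"
    unfolding sum_distrib_left by (subst sum.swap) (auto simp: Asym mult_ac intro!: sum.cong)
  hence "(\<Sum>i<n. y i * (Re z * x i - Im z * y i)) = (\<Sum>i<n. x i * (Re z * y i + Im z * x i))"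
    by (simp add: Ax Ay)
  hence "(\<Sum>i<n. Im z * ((x i)\<^sup>2 + (y i)\<^sup>2)) = 0"
    by (simp add: algebra_simps power2_eq_square sum.distrib sum_subtractf)
  hence "Im z * (\<Sum>i<n. (x i)\<^sup>2 + (y i)\<^sup>2) = 0"
    by (simp add: sum_distrib_left)
  moreover have "(\<Sum>i<n. (x i)\<^sup>2 + (y i)\<^sup>2) \<noteq> 0"
  proof
    assume "(\<Sum>i<n. (x i)\<^sup>2 + (y i)\<^sup>2) = 0"
    hence "\<forall>i<n. (x i)\<^sup>2 + (y i)\<^sup>2 = 0"
      by (subst (asm) sum_nonneg_eq_0_iff) auto
    hence "v = 0\<^sub>v n"
      using v(1) by (auto simp: x_def y_def complex_eq_iff)
    with v(2) show False by simp
  qed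
  ultimately have Im: "Im z = 0" by simp
  have "\<exists>w. (\<forall>i<n. (\<Sum>j<n. A $$ (i, j) * w j) = Re z * w i) \<and> (\<exists>i<n. w i \<noteq> 0)"
  proof (cases "\<exists>i<n. x i \<noteq> 0")
    case True
    thus ?thesis using Ax Im by (intro exI[of _ x]) auto
  next
    case False
    hence "\<exists>i<n. y i \<noteq> 0"
      using v(1,2) by (auto simp: x_def y_def complex_eq_iff)
    thus ?thesis using Ay Im by (intro exI[of _ y]) auto
  qed
  then obtain w where w: "\<And>i. i < n \<Longrightarrow> (\<Sum>j<n. A $$ (i, j) * w j) = Re z * w i" "\<exists>i<n. w i \<noteq> 0"
    by blast
  define N where "N = (\<Sum>i<n. (w i)\<^sup>2)"
  have "N > 0"
    using w(2) unfolding N_def by (auto intro!: sum_pos2)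
  define u where "u = vec n (\<lambda>i. w i / sqrt N)"
  have "scalar_prod u u = (\<Sum>i<n. (w i)\<^sup>2 / N)"
    using \<open>N > 0\<close> by (auto simp: u_def scalar_prod_def atLeast0LessThan power2_eq_square intro!: sum.cong)
  also have "\<dots> = 1"
    using \<open>N > 0\<close> by (simp add: sum_divide_distrib[symmetric] N_def)
  finally have "scalar_prod u u = 1" .
  moreover have "A *\<^sub>v u = Re z \<cdot>\<^sub>v u"
  proof
    fix i assume i: "i < dim_vec (Re z \<cdot>\<^sub>v u)"
    hence "(A *\<^sub>v u) $ i = (\<Sum>j<n. A $$ (i, j) * w j) / sqrt N"
      using A by (auto simp: u_def scalar_prod_def atLeast0LessThan sum_divide_distrib intro!: sum.cong)
    thus "(A *\<^sub>v u) $ i = (Re z \<cdot>\<^sub>v u) $ i"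
      using i w(1)[of i] by (simp add: u_def)
  qed (use A in \<open>simp add: u_def\<close>)
  ultimately show ?thesis
    by (intro exI[of _ "Re z"] exI[of _ u]) (auto simp: u_def)
qed

text \<open>
  The reflection along \<open>u = v - e\<^sub>0\<close> exchanges the unit vectors \<open>e\<^sub>0\<close> and \<open>v\<close>. For \<open>u = 0\<close> the factor
  \<open>c = 2 / \<bar>u\<bar>\<^sup>2\<close> is \<open>2 / 0 = 0\<close>, so the same formula yields the identity, as it should.
\<close>

lemma householder_reflection_exists:
  fixes v :: "real vec"
  assumes v: "v \<in> carrier_vec (Suc m)" and unit: "scalar_prod v v = 1"
  shows "\<exists>H \<in> carrier_mat (Suc m) (Suc m). H\<^sup>T = H \<and> H * H = 1\<^sub>m (Suc m) \<and> H *\<^sub>v unit_vec (Suc m) 0 = v"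
proof -
  let ?n = "Suc m"
  define u where "u i = v $ i - (if i = 0 then 1 else 0)" for i
  define U where "U = (\<Sum>i<?n. u i * u i)"
  define c where "c = 2 / U"
  have cU: "c * c * U = 2 * c" by (simp add: c_def)
  have vv: "(\<Sum>i<?n. v $ i * v $ i) = 1"
    using unit v by (simp add: scalar_prod_def atLeast0LessThan)
  have "U = (\<Sum>i<?n. v $ i * v $ i - 2 * (if i = 0 then v $ 0 else 0) + (if i = 0 then 1 else 0))"
    unfolding U_def u_def by (intro sum.cong) (auto simp: algebra_simps)
  also have "\<dots> = (\<Sum>i<?n. v $ i * v $ i) - 2 * v $ 0 + 1"
    by (simp only: sum.distrib sum_subtractf sum_distrib_left[symmetric]) simp
  finally have U: "U = 2 - 2 * v $ 0" using vv by simp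
  define H where "H = mat ?n ?n (\<lambda>(i, j). (if i = j then 1 else 0) - c * u i * u j)"
  have H: "H \<in> carrier_mat ?n ?n" by (simp add: H_def)
  have "H\<^sup>T = H" by (auto simp: H_def)
  moreover have "H * H = 1\<^sub>m ?n"
  proof
    fix i j assume ij: "i < dim_row (1\<^sub>m ?n)" "j < dim_col (1\<^sub>m ?n)"
    have "(H * H) $$ (i, j) = (\<Sum>k<?n. ((if i = k then 1 else 0) - c * u i * u k) *
             ((if k = j then 1 else 0) - c * u k * u j))"
      using ij by (auto simp: H_def scalar_prod_def atLeast0LessThan intro!: sum.cong)
    also have "\<dots> = (\<Sum>k<?n. (if i = k then (if k = j then 1 else 0) else 0)
          - (if i = k then c * u i * u j else 0) - (if k = j then c * u i * u j else 0)
          + c * c * u i * u j * (u k * u k))"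
      by (intro sum.cong) (auto simp: algebra_simps)
    also have "\<dots> = (if i = j then 1 else 0) - 2 * (c * u i * u j) + c * c * u i * u j * U"
      using ij by (simp only: sum.distrib sum_subtractf sum_distrib_left[symmetric] U_def[symmetric]) auto
    also have "c * c * u i * u j * U = (c * c * U) * u i * u j" by simp
    finally show "(H * H) $$ (i, j) = 1\<^sub>m ?n $$ (i, j)"
      using ij by (simp add: cU)
  qed (auto simp: H_def)
  moreover have "H *\<^sub>v unit_vec ?n 0 = v"
  proof
    fix i assume i: "i < dim_vec v"
    hence i': "i < ?n" using v by simp
    have "(H *\<^sub>v unit_vec ?n 0) $ i = H $$ (i, 0)"
      using i' H by (simp add: mult_mat_vec_def)
    also have "\<dots> = (if i = 0 then 1 else 0) - c * u 0 * u i"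
      using i' by (simp add: H_def)
    also have "c * u 0 * u i = - u i"
    proof (cases "U = 0")
      case True
      hence "\<forall>i\<in>{..<?n}. u i * u i = 0"
        unfolding U_def by (subst (asm) sum_nonneg_eq_0_iff) auto
      thus ?thesis using i' by auto
    next
      case False
      hence "c * u 0 = - 1"
        by (simp add: c_def u_def U field_simps)
      thus ?thesis by simp
    qed
    finally show "(H *\<^sub>v unit_vec ?n 0) $ i = v $ i" by (simp add: u_def)
  qed (use v in \<open>simp add: H_def\<close>)
  ultimately show ?thesis using H by blast
qed

text \<open>
  Conjugation with a reflection that takes \<open>e\<^sub>0\<close> to a unit eigenvector makes \<open>e\<^sub>0\<close> an eigenvector. By
  symmetry the first row then vanishes off the diagonal as well, and the remaining block is smaller.
\<close>

lemma real_symmetric_diagonalization: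
  fixes A :: "real mat"
  assumes "A \<in> carrier_mat n n" and "A\<^sup>T = A"
  shows "\<exists>Q \<in> carrier_mat n n. \<exists>D \<in> carrier_mat n n. diagonal_mat D \<and>
           Q * Q\<^sup>T = 1\<^sub>m n \<and> Q\<^sup>T * Q = 1\<^sub>m n \<and> A = Q * D * Q\<^sup>T"
  using assms
proof (induction n arbitrary: A)
  case 0
  thus ?case
    by (intro bexI[of _ "1\<^sub>m 0"] bexI[of _ A]) (auto simp: diagonal_mat_def)
next
  case (Suc m)
  let ?n = "Suc m"
  note A = Suc.prems(1)
  obtain e v where v: "v \<in> carrier_vec ?n" "scalar_prod v v = 1" "A *\<^sub>v v = e \<cdot>\<^sub>v v"
    using symmetric_mat_real_eigenvector[OF Suc.prems] by auto
  obtain H where H: "H \<in> carrier_mat ?n ?n" "H\<^sup>T = H" "H * H = 1\<^sub>m ?n"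
      and Hv: "H *\<^sub>v unit_vec ?n 0 = v"
    using householder_reflection_exists[OF v(1,2)] by blast
  define B where "B = H * A * H"
  have B: "B \<in> carrier_mat ?n ?n" using A H by (simp add: B_def)
  have Bsym: "B\<^sup>T = B"
    using A H Suc.prems(2) by (simp add: B_def transpose_mult[of _ ?n ?n _ ?n] assoc_mult_mat[of _ ?n ?n _ ?n _ ?n])
  have "H *\<^sub>v v = unit_vec ?n 0"
    using H unfolding Hv[symmetric]
    by (simp add: assoc_mult_mat_vec[symmetric, of _ ?n ?n _ ?n])
  hence Be0: "B *\<^sub>v unit_vec ?n 0 = e \<cdot>\<^sub>v unit_vec ?n 0"
    using A H v by (simp add: B_def assoc_mult_mat_vec[of _ ?n ?n _ ?n] Hv mult_mat_vec[of _ ?n ?n])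
  have B0: "B $$ (i, 0) = (if i = 0 then e else 0)" if "i < ?n" for i
  proof -
    have "B $$ (i, 0) = (B *\<^sub>v unit_vec ?n 0) $ i"
      using that B by (simp add: mult_mat_vec_def)
    thus ?thesis using that by (simp add: Be0)
  qed
  have Bs: "B $$ (i, j) = B $$ (j, i)" if "i < ?n" "j < ?n" for i j
    using that B Bsym by (metis carrier_matD index_transpose_mat(1))
  define E where "E = mat 1 1 (\<lambda>_. e)"
  define A' where "A' = mat m m (\<lambda>(i, j). B $$ (Suc i, Suc j))"
  have A': "A' \<in> carrier_mat m m" "A'\<^sup>T = A'"
    using Bs by (auto simp: A'_def)
  have Bblock: "B = four_block_mat E (0\<^sub>m 1 m) (0\<^sub>m m 1) A'"
    using B B0 Bs[of 0] by (intro eq_matI) (auto simp: E_def A'_def)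
  obtain P D where P: "P \<in> carrier_mat m m" "D \<in> carrier_mat m m" "diagonal_mat D"
      "P * P\<^sup>T = 1\<^sub>m m" "P\<^sup>T * P = 1\<^sub>m m" "A' = P * D * P\<^sup>T"
    using Suc.IH[OF A'] by blast
  define P' where "P' = four_block_mat (1\<^sub>m 1) (0\<^sub>m 1 m) (0\<^sub>m m 1) P"
  define D' where "D' = four_block_mat E (0\<^sub>m 1 m) (0\<^sub>m m 1) D"
  have E: "E \<in> carrier_mat 1 1" by (simp add: E_def)
  have P': "P' \<in> carrier_mat ?n ?n" "D' \<in> carrier_mat ?n ?n"
    using P E by (auto simp: P'_def D'_def)
  have P'T: "P'\<^sup>T = four_block_mat (1\<^sub>m 1) (0\<^sub>m 1 m) (0\<^sub>m m 1) P\<^sup>T"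
    using P by (simp add: P'_def transpose_four_block_mat[of _ 1 1 _ m _ m])
  have one: "four_block_mat (1\<^sub>m 1) (0\<^sub>m 1 m) (0\<^sub>m m 1) (1\<^sub>m m) = (1\<^sub>m ?n :: real mat)"
    by (intro eq_matI) auto
  have P'1: "P' * P'\<^sup>T = 1\<^sub>m ?n" and P'2: "P'\<^sup>T * P' = 1\<^sub>m ?n"
    unfolding P'T unfolding P'_def using P
    by (simp_all add: mult_four_block_mat[of _ 1 1 _ m _ m _ _ 1 _ m] one)
  have BP: "B = P' * D' * P'\<^sup>T"
    unfolding P'T Bblock unfolding P'_def D'_def using P E
    by (simp add: mult_four_block_mat[of _ 1 1 _ m _ m _ _ 1 _ m])
  have HH: "H * (H * X) = X" if "X \<in> carrier_mat ?n ?n" for X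
    using that H by (simp add: assoc_mult_mat[symmetric, of _ ?n ?n _ ?n _ ?n])
  have PP: "P' * (P'\<^sup>T * X) = X" "P'\<^sup>T * (P' * X) = X" if "X \<in> carrier_mat ?n ?n" for X
    using that P' P'1 P'2 by (simp_all add: assoc_mult_mat[symmetric, of _ ?n ?n _ ?n _ ?n])
  have QT: "(H * P')\<^sup>T = P'\<^sup>T * H"
    using H P' by (simp add: transpose_mult[of _ ?n ?n _ ?n])
  note as = assoc_mult_mat[of _ ?n ?n _ ?n _ ?n]
  have "A = H * B * H"
    using A H by (simp add: B_def as HH)
  also have "\<dots> = (H * P') * D' * (H * P')\<^sup>T"
    using H P' by (simp add: BP QT as)
  finally have "A = (H * P') * D' * (H * P')\<^sup>T" .
  moreover have "diagonal_mat D'"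
    using P(2,3) by (auto simp: diagonal_mat_def D'_def E_def)
  moreover have "(H * P') * (H * P')\<^sup>T = 1\<^sub>m ?n" "(H * P')\<^sup>T * (H * P') = 1\<^sub>m ?n"
    using H P' P'2 by (simp_all add: QT as HH PP)
  ultimately show ?case
    using H P' by (intro bexI[of _ "H * P'"] bexI[of _ D']) auto
qed

text \<open>
  From here on a matrix is given by a function of two indices of which only the values below \<open>n\<close> count.
  This form keeps the analysis in terms of finite sums.
\<close>

lemma spectral_theorem_real_symmetric:
  fixes A :: "nat \<Rightarrow> nat \<Rightarrow> real"
  assumes sym: "\<And>i j. A i j = A j i"
  shows "\<exists>Q e. (\<forall>i<n. \<forall>j<n. (\<Sum>k<n. Q i k * Q j k) = of_bool (i = j)) \<and>
               (\<forall>k<n. \<forall>l<n. (\<Sum>i<n. Q i k * Q i l) = of_bool (k = l)) \<and>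
               (\<forall>i<n. \<forall>j<n. A i j = (\<Sum>k<n. Q i k * e k * Q j k)) \<and>
               energy (mat n n (\<lambda>(i, j). A i j)) = (\<Sum>k<n. \<bar>e k\<bar>)"
proof -
  let ?A = "mat n n (\<lambda>(i, j). A i j)"
  have A: "?A \<in> carrier_mat n n" "?A\<^sup>T = ?A"
    using sym by auto
  obtain Q D where Q: "Q \<in> carrier_mat n n" and D: "D \<in> carrier_mat n n" "diagonal_mat D"
      and QQ: "Q * Q\<^sup>T = 1\<^sub>m n" "Q\<^sup>T * Q = 1\<^sub>m n" and AQ: "?A = Q * D * Q\<^sup>T"
    using real_symmetric_diagonalization[OF A] by blast
  have "similar_mat_wit ?A D Q Q\<^sup>T"
    using A Q D QQ AQ by (auto simp: similar_mat_wit_def Let_def)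
  hence "char_poly ?A = char_poly D"
    by (intro char_poly_similar) (auto simp: similar_mat_def)
  also have "\<dots> = (\<Prod>x\<leftarrow>diag_mat D. [:- x, 1:])"
    using D by (intro char_poly_upper_triangular[of D n]) (auto simp: diagonal_mat_def)
  finally have "energy ?A = (\<Sum>x\<leftarrow>diag_mat D. \<bar>x\<bar>)"
    by (rule energy_eq_sum_list[OF A(1)])
  also have "\<dots> = (\<Sum>k<n. \<bar>D $$ (k, k)\<bar>)"
    using D by (simp add: diag_mat_def o_def interv_sum_list_conv_sum_set_nat atLeast0LessThan)
  finally have en: "energy ?A = (\<Sum>k<n. \<bar>D $$ (k, k)\<bar>)" .
  have rows: "(\<Sum>k<n. Q $$ (i, k) * Q $$ (j, k)) = of_bool (i = j)" if "i < n" "j < n" for i j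
  proof -
    have "(\<Sum>k<n. Q $$ (i, k) * Q $$ (j, k)) = (Q * Q\<^sup>T) $$ (i, j)"
      using that Q by (auto simp: scalar_prod_def atLeast0LessThan intro!: sum.cong)
    also have "(Q * Q\<^sup>T) $$ (i, j) = of_bool (i = j)"
      using that by (simp add: QQ)
    finally show ?thesis .
  qed
  have cols: "(\<Sum>i<n. Q $$ (i, k) * Q $$ (i, l)) = of_bool (k = l)" if "k < n" "l < n" for k l
  proof -
    have "(\<Sum>i<n. Q $$ (i, k) * Q $$ (i, l)) = (Q\<^sup>T * Q) $$ (k, l)"
      using that Q by (auto simp: scalar_prod_def atLeast0LessThan intro!: sum.cong)
    also have "(Q\<^sup>T * Q) $$ (k, l) = of_bool (k = l)"
      using that by (simp add: QQ)
    finally show ?thesis .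
  qed
  have dec: "A i j = (\<Sum>k<n. Q $$ (i, k) * D $$ (k, k) * Q $$ (j, k))" if "i < n" "j < n" for i j
  proof -
    have QD: "(Q * D) $$ (i, k) = Q $$ (i, k) * D $$ (k, k)" if "k < n" for k
    proof -
      have "(Q * D) $$ (i, k) = (\<Sum>l<n. Q $$ (i, l) * D $$ (l, k))"
        using that \<open>i < n\<close> Q D by (auto simp: scalar_prod_def atLeast0LessThan intro!: sum.cong)
      also have "\<dots> = (\<Sum>l<n. if l = k then Q $$ (i, k) * D $$ (k, k) else 0)"
        using that D by (intro sum.cong) (auto simp: diagonal_mat_def)
      finally show ?thesis using that by simp
    qed
    define M where "M = Q * D"
    have M: "M \<in> carrier_mat n n" using Q D by (simp add: M_def)
    have "A i j = (M * Q\<^sup>T) $$ (i, j)"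
      using that AQ unfolding M_def by (metis (no_types, lifting) case_prod_conv index_mat(1))
    also have "\<dots> = (\<Sum>k<n. M $$ (i, k) * Q $$ (j, k))"
      using that Q M by (auto simp: scalar_prod_def atLeast0LessThan intro!: sum.cong)
    finally show ?thesis by (simp add: M_def QD)
  qed
  show ?thesis
    by (intro exI[of _ "\<lambda>i k. Q $$ (i, k)"] exI[of _ "\<lambda>k. D $$ (k, k)"])
       (use rows cols dec en in auto)
qed

section \<open>Functional calculus and the energy as a trace norm\<close>

definition symmetric_kernel :: "(nat \<Rightarrow> nat \<Rightarrow> real) \<Rightarrow> bool" where
  "symmetric_kernel A \<longleftrightarrow> (\<forall>i j. A i j = A j i)"

definition kernel_energy :: "nat \<Rightarrow> (nat \<Rightarrow> nat \<Rightarrow> real) \<Rightarrow> real" where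
  "kernel_energy n A = energy (mat n n (\<lambda>(i, j). A i j))"

definition is_eigensystem :: "nat \<Rightarrow> (nat \<Rightarrow> nat \<Rightarrow> real) \<Rightarrow> (nat \<Rightarrow> nat \<Rightarrow> real) \<Rightarrow> (nat \<Rightarrow> real) \<Rightarrow> bool" where
  "is_eigensystem n A Q e \<longleftrightarrow>
     (\<forall>i<n. \<forall>j<n. (\<Sum>k<n. Q i k * Q j k) = of_bool (i = j)) \<and>
     (\<forall>k<n. \<forall>l<n. (\<Sum>i<n. Q i k * Q i l) = of_bool (k = l)) \<and>
     (\<forall>i<n. \<forall>j<n. A i j = (\<Sum>k<n. Q i k * e k * Q j k)) \<and>
     kernel_energy n A = (\<Sum>k<n. \<bar>e k\<bar>)"

text \<open>
  A choice of eigenbasis is fixed so that functions of \<open>A\<close> become explicit sums; their values do not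
  depend on it.
\<close>

definition eigensystem :: "nat \<Rightarrow> (nat \<Rightarrow> nat \<Rightarrow> real) \<Rightarrow> (nat \<Rightarrow> nat \<Rightarrow> real) \<times> (nat \<Rightarrow> real)" where
  "eigensystem n A = (SOME (Q, e). is_eigensystem n A Q e)"

definition evec :: "nat \<Rightarrow> (nat \<Rightarrow> nat \<Rightarrow> real) \<Rightarrow> nat \<Rightarrow> nat \<Rightarrow> real" where
  "evec n A = fst (eigensystem n A)"

definition ev :: "nat \<Rightarrow> (nat \<Rightarrow> nat \<Rightarrow> real) \<Rightarrow> nat \<Rightarrow> real" where
  "ev n A = snd (eigensystem n A)"

lemma is_eigensystem_ev:
  assumes "symmetric_kernel A"
  shows "is_eigensystem n A (evec n A) (ev n A)"
proof -
  have "\<exists>Q e. is_eigensystem n A Q e"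
    using assms unfolding is_eigensystem_def kernel_energy_def symmetric_kernel_def
    by (intro spectral_theorem_real_symmetric) auto
  hence "\<exists>x. case x of (Q, e) \<Rightarrow> is_eigensystem n A Q e" by auto
  from someI_ex[OF this] show ?thesis
    by (simp add: eigensystem_def evec_def ev_def case_prod_unfold)
qed

lemma
  assumes "symmetric_kernel A"
  shows evec_rows: "i < n \<Longrightarrow> j < n \<Longrightarrow> (\<Sum>k<n. evec n A i k * evec n A j k) = of_bool (i = j)"
    and evec_cols: "k < n \<Longrightarrow> l < n \<Longrightarrow> (\<Sum>i<n. evec n A i k * evec n A i l) = of_bool (k = l)"
    and kernel_eq_ev: "i < n \<Longrightarrow> j < n \<Longrightarrow> A i j = (\<Sum>k<n. evec n A i k * ev n A k * evec n A j k)"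
    and kernel_energy_eq: "kernel_energy n A = (\<Sum>k<n. \<bar>ev n A k\<bar>)"
  using is_eigensystem_ev[OF assms, of n] unfolding is_eigensystem_def by simp_all

text \<open>
  The \<open>(i, j)\<close> entry of \<open>f(A)\<close> in the functional calculus. Complex values of \<open>f\<close> are needed for the
  resolvent, real ones for the sign of \<open>A\<close>.
\<close>

definition spectral_fun :: "nat \<Rightarrow> (nat \<Rightarrow> nat \<Rightarrow> real) \<Rightarrow> (real \<Rightarrow> complex) \<Rightarrow> nat \<Rightarrow> nat \<Rightarrow> complex" where
  "spectral_fun n A f i j = (\<Sum>k<n. of_real (evec n A i k) * f (ev n A k) * of_real (evec n A j k))"

lemma spectral_fun_sym: "spectral_fun n A f i j = spectral_fun n A f j i"
  by (simp add: spectral_fun_def mult_ac)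

lemma spectral_fun_add:
  "spectral_fun n A (\<lambda>x. f x + g x) i j = spectral_fun n A f i j + spectral_fun n A g i j"
  by (simp add: spectral_fun_def algebra_simps sum.distrib)

lemma spectral_fun_scale:
  "spectral_fun n A (\<lambda>x. c * f x) i j = c * spectral_fun n A f i j"
  by (simp add: spectral_fun_def sum_distrib_left mult_ac)

lemma spectral_fun_cnj: "spectral_fun n A (\<lambda>x. cnj (f x)) i j = cnj (spectral_fun n A f i j)"
  by (simp add: spectral_fun_def)

lemma spectral_fun_id:
  assumes "symmetric_kernel A" "i < n" "j < n"
  shows "spectral_fun n A of_real i j = of_real (A i j)"
  by (simp add: spectral_fun_def kernel_eq_ev[OF assms])

lemma spectral_fun_one:
  assumes "symmetric_kernel A" "i < n" "j < n"
  shows "spectral_fun n A (\<lambda>_. 1) i j = of_bool (i = j)"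
proof -
  have "spectral_fun n A (\<lambda>_. 1) i j = of_real (\<Sum>k<n. evec n A i k * evec n A j k)"
    by (simp add: spectral_fun_def)
  thus ?thesis by (simp add: evec_rows[OF assms])
qed

lemma evec_cols_complex:
  assumes "symmetric_kernel A" "k < n" "l < n"
  shows "(\<Sum>i<n. complex_of_real (evec n A i k) * of_real (evec n A i l)) = of_bool (k = l)"
proof -
  have "(\<Sum>i<n. complex_of_real (evec n A i k) * of_real (evec n A i l)) =
          of_real (\<Sum>i<n. evec n A i k * evec n A i l)" by simp
  thus ?thesis by (simp add: evec_cols[OF assms])
qed

lemma spectral_fun_mult:
  assumes A: "symmetric_kernel A"
  shows "(\<Sum>j<n. spectral_fun n A f i j * spectral_fun n A g j k) = spectral_fun n A (\<lambda>x. f x * g x) i k"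
proof -
  let ?q = "\<lambda>i k. complex_of_real (evec n A i k)"
  let ?F = "\<lambda>l. ?q i l * f (ev n A l)" and ?G = "\<lambda>m. g (ev n A m) * ?q k m"
  have "(\<Sum>j<n. spectral_fun n A f i j * spectral_fun n A g j k) =
          (\<Sum>j<n. \<Sum>l<n. \<Sum>m<n. ?F l * ?G m * (?q j l * ?q j m))"
    unfolding spectral_fun_def sum_product by (intro sum.cong refl) (simp add: mult_ac)
  also have "\<dots> = (\<Sum>l<n. \<Sum>j<n. \<Sum>m<n. ?F l * ?G m * (?q j l * ?q j m))"
    by (rule sum.swap)
  also have "\<dots> = (\<Sum>l<n. \<Sum>m<n. \<Sum>j<n. ?F l * ?G m * (?q j l * ?q j m))"
    by (intro sum.cong refl sum.swap)
  also have "\<dots> = (\<Sum>l<n. \<Sum>m<n. if m = l then ?F l * ?G m else 0)"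
    by (intro sum.cong refl) (auto simp: sum_distrib_left[symmetric] evec_cols_complex[OF A])
  also have "\<dots> = spectral_fun n A (\<lambda>x. f x * g x) i k"
    by (simp add: spectral_fun_def mult_ac)
  finally show ?thesis .
qed

lemma spectral_fun_trace:
  assumes A: "symmetric_kernel A"
  shows "(\<Sum>i<n. spectral_fun n A f i i) = (\<Sum>k<n. f (ev n A k))"
proof -
  have "(\<Sum>i<n. spectral_fun n A f i i) =
          (\<Sum>k<n. f (ev n A k) * (\<Sum>i<n. of_real (evec n A i k) * of_real (evec n A i k)))"
    unfolding spectral_fun_def sum_distrib_left by (subst sum.swap) (simp add: mult_ac)
  thus ?thesis by (simp add: evec_cols_complex[OF A])
qed

text \<open>
  The row sum is a diagonal entry of \<open>\<bar>f\<bar>\<^sup>2(A)\<close>, a weighted mean of the values \<open>\<bar>f\<bar>\<^sup>2\<close> whose weights are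
  the squares of a row of an orthogonal matrix.
\<close>

lemma spectral_fun_row_norm:
  assumes A: "symmetric_kernel A" and b: "\<And>x. cmod (f x) \<le> b" and i: "i < n"
  shows "(\<Sum>j<n. (cmod (spectral_fun n A f i j))\<^sup>2) \<le> b\<^sup>2"
proof -
  have b0: "0 \<le> b" using b[of 0] norm_ge_zero order_trans by blast
  have "complex_of_real (\<Sum>j<n. (cmod (spectral_fun n A f i j))\<^sup>2) =
          (\<Sum>j<n. spectral_fun n A f i j * spectral_fun n A (\<lambda>x. cnj (f x)) j i)"
    by (simp add: spectral_fun_cnj spectral_fun_sym[of n A f _ i] complex_norm_square del: of_real_power)
  also have "\<dots> = spectral_fun n A (\<lambda>x. f x * cnj (f x)) i i"
    by (rule spectral_fun_mult[OF A])
  also have "\<dots> = of_real (\<Sum>k<n. (evec n A i k * evec n A i k) * (cmod (f (ev n A k)))\<^sup>2)"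
    by (simp add: spectral_fun_def complex_norm_square[symmetric] mult_ac)
  finally have "(\<Sum>j<n. (cmod (spectral_fun n A f i j))\<^sup>2) =
      (\<Sum>k<n. (evec n A i k * evec n A i k) * (cmod (f (ev n A k)))\<^sup>2)"
    by (simp only: of_real_eq_iff)
  also have "\<dots> \<le> (\<Sum>k<n. (evec n A i k * evec n A i k) * b\<^sup>2)"
    using b by (intro sum_mono mult_left_mono power_mono) auto
  also have "\<dots> = b\<^sup>2"
    by (simp add: sum_distrib_right[symmetric] evec_rows[OF A i i])
  finally show ?thesis .
qed

lemma spectral_fun_entry_norm:
  assumes A: "symmetric_kernel A" and b: "\<And>x. cmod (f x) \<le> b" and i: "i < n" "j < n"
  shows "cmod (spectral_fun n A f i j) \<le> b"
proof -
  have b0: "0 \<le> b" using b[of 0] norm_ge_zero order_trans by blast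
  have "(cmod (spectral_fun n A f i j))\<^sup>2 \<le> (\<Sum>j<n. (cmod (spectral_fun n A f i j))\<^sup>2)"
    using i by (intro member_le_sum) auto
  also have "\<dots> \<le> b\<^sup>2" by (rule spectral_fun_row_norm[OF A b i(1)])
  finally show ?thesis using b0 by (simp add: power2_le_iff_abs_le)
qed

text \<open>
  In the coordinates \<open>y\<close> of \<open>v\<close> in the eigenbasis the form is diagonal, and \<open>\<bar>y\<bar> = \<bar>v\<bar>\<close>.
\<close>

lemma spectral_fun_quadratic_form:
  fixes v :: "nat \<Rightarrow> real"
  assumes A: "symmetric_kernel A" and b: "\<And>x. cmod (f x) \<le> 1"
  shows "cmod (\<Sum>i<n. \<Sum>j<n. of_real (v i) * spectral_fun n A f i j * of_real (v j)) \<le> (\<Sum>i<n. (v i)\<^sup>2)"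
proof -
  define y where "y k = (\<Sum>i<n. v i * evec n A i k)" for k
  have y2: "of_real ((y k)\<^sup>2) = (\<Sum>i<n. \<Sum>j<n. complex_of_real (v i * evec n A i k * (v j * evec n A j k)))" for k
    by (simp add: y_def power2_eq_square sum_product)
  have "(\<Sum>i<n. \<Sum>j<n. of_real (v i) * spectral_fun n A f i j * of_real (v j)) =
        (\<Sum>i<n. \<Sum>j<n. \<Sum>k<n. f (ev n A k) * of_real (v i * evec n A i k * (v j * evec n A j k)))"
    by (simp add: spectral_fun_def sum_distrib_left sum_distrib_right mult_ac)
  also have "\<dots> = (\<Sum>i<n. \<Sum>k<n. \<Sum>j<n. f (ev n A k) * of_real (v i * evec n A i k * (v j * evec n A j k)))"
    by (intro sum.cong refl sum.swap)
  also have "\<dots> = (\<Sum>k<n. \<Sum>i<n. \<Sum>j<n. f (ev n A k) * of_real (v i * evec n A i k * (v j * evec n A j k)))"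
    by (rule sum.swap)
  also have "\<dots> = (\<Sum>k<n. f (ev n A k) * of_real ((y k)\<^sup>2))"
    unfolding y2 sum_distrib_left ..
  also have "cmod \<dots> \<le> (\<Sum>k<n. (y k)\<^sup>2)"
    using b by (intro sum_norm_le) (auto simp: norm_mult norm_power intro!: mult_left_le_one_le)
  also have "\<dots> = (\<Sum>k<n. \<Sum>i<n. \<Sum>j<n. v i * v j * (evec n A i k * evec n A j k))"
    by (simp add: y_def power2_eq_square sum_product mult_ac)
  also have "\<dots> = (\<Sum>i<n. \<Sum>k<n. \<Sum>j<n. v i * v j * (evec n A i k * evec n A j k))"
    by (rule sum.swap)
  also have "\<dots> = (\<Sum>i<n. \<Sum>j<n. \<Sum>k<n. v i * v j * (evec n A i k * evec n A j k))"
    by (intro sum.cong refl sum.swap)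
  also have "\<dots> = (\<Sum>i<n. \<Sum>j<n. if j = i then v i * v j else 0)"
    by (intro sum.cong refl) (auto simp: sum_distrib_left[symmetric] evec_rows[OF A])
  also have "\<dots> = (\<Sum>i<n. (v i)\<^sup>2)"
    by (simp add: power2_eq_square)
  finally show ?thesis .
qed

text \<open>
  Trace norm duality: \<open>\<bar>tr (B S)\<bar>\<close> is at most the trace norm of \<open>B\<close> for every contraction \<open>S\<close>. Expanding
  \<open>B\<close> in its own eigenvectors \<open>q\<^sub>k\<close> leaves the numbers \<open>q\<^sub>k \<cdot> S q\<^sub>k\<close>, which are at most \<open>1\<close> in absolute value.
\<close>

lemma trace_pairing_le_energy:
  assumes A: "symmetric_kernel A" and B: "symmetric_kernel B" and b: "\<And>x. cmod (f x) \<le> 1"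
  shows "cmod (\<Sum>i<n. \<Sum>j<n. of_real (B i j) * spectral_fun n A f i j) \<le> kernel_energy n B"
proof -
  let ?q = "\<lambda>i k. complex_of_real (evec n B i k)"
  let ?T = "\<lambda>i j k. of_real (ev n B k) * (?q i k * spectral_fun n A f i j * ?q j k)"
  have "(\<Sum>i<n. \<Sum>j<n. of_real (B i j) * spectral_fun n A f i j) = (\<Sum>i<n. \<Sum>j<n. \<Sum>k<n. ?T i j k)"
  proof (intro sum.cong refl)
    fix i j assume ij: "i \<in> {..<n}" "j \<in> {..<n}"
    hence "of_real (B i j) = (\<Sum>k<n. ?q i k * of_real (ev n B k) * ?q j k)"
      using kernel_eq_ev[OF B, where i = i and j = j and n = n] by simp
    thus "of_real (B i j) * spectral_fun n A f i j = (\<Sum>k<n. ?T i j k)"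
      by (simp only: sum_distrib_right) (simp add: mult_ac)
  qed
  also have "\<dots> = (\<Sum>i<n. \<Sum>k<n. \<Sum>j<n. ?T i j k)"
    by (intro sum.cong refl sum.swap)
  also have "\<dots> = (\<Sum>k<n. \<Sum>i<n. \<Sum>j<n. ?T i j k)"
    by (rule sum.swap)
  also have "\<dots> = (\<Sum>k<n. of_real (ev n B k) * (\<Sum>i<n. \<Sum>j<n. ?q i k * spectral_fun n A f i j * ?q j k))"
    unfolding sum_distrib_left ..
  finally have eq: "(\<Sum>i<n. \<Sum>j<n. of_real (B i j) * spectral_fun n A f i j) =
      (\<Sum>k<n. of_real (ev n B k) * (\<Sum>i<n. \<Sum>j<n. ?q i k * spectral_fun n A f i j * ?q j k))" .
  show ?thesis
    unfolding eq kernel_energy_eq[OF B]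
  proof (intro sum_norm_le)
    fix k assume k: "k \<in> {..<n}"
    have "cmod (\<Sum>i<n. \<Sum>j<n. ?q i k * spectral_fun n A f i j * ?q j k) \<le> (\<Sum>i<n. (evec n B i k)\<^sup>2)"
      by (rule spectral_fun_quadratic_form[OF A b])
    also have "\<dots> = 1"
      using evec_cols[OF B, of k n k] k by (simp add: power2_eq_square)
    finally show "cmod (of_real (ev n B k) * (\<Sum>i<n. \<Sum>j<n. ?q i k * spectral_fun n A f i j * ?q j k)) \<le> \<bar>ev n B k\<bar>"
      unfolding norm_mult by (simp add: mult_left_le)
  qed
qed

text \<open>
  Cauchy-Schwarz for the Frobenius norm; that of a contraction is at most \<open>sqrt n\<close>.
\<close>

lemma norm_sum_pairing_le:
  assumes A: "symmetric_kernel A" and b: "\<And>x. cmod (f x) \<le> 1"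
  shows "cmod (\<Sum>i<n. \<Sum>j<n. of_real (F i j) * spectral_fun n A f i j) \<le>
           sqrt (real n) * sqrt (\<Sum>i<n. \<Sum>j<n. (F i j)\<^sup>2)"
proof -
  let ?S = "spectral_fun n A f"
  have "cmod (\<Sum>i<n. \<Sum>j<n. of_real (F i j) * ?S i j) \<le> (\<Sum>i<n. \<Sum>j<n. \<bar>F i j\<bar> * \<bar>cmod (?S i j)\<bar>)"
    by (intro sum_norm_le) (simp add: norm_mult)
  also have "\<dots> = (\<Sum>x\<in>{..<n} \<times> {..<n}. \<bar>case x of (i, j) \<Rightarrow> F i j\<bar> * \<bar>case x of (i, j) \<Rightarrow> cmod (?S i j)\<bar>)"
    by (simp add: sum.cartesian_product case_prod_unfold)
  also have "\<dots> \<le> L2_set (\<lambda>(i, j). F i j) ({..<n} \<times> {..<n}) * L2_set (\<lambda>(i, j). cmod (?S i j)) ({..<n} \<times> {..<n})"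
    by (rule L2_set_mult_ineq)
  also have "L2_set (\<lambda>(i, j). F i j) ({..<n} \<times> {..<n}) = sqrt (\<Sum>i<n. \<Sum>j<n. (F i j)\<^sup>2)"
    by (simp add: L2_set_def sum.cartesian_product case_prod_unfold)
  also have "L2_set (\<lambda>(i, j). cmod (?S i j)) ({..<n} \<times> {..<n}) = sqrt (\<Sum>i<n. \<Sum>j<n. (cmod (?S i j))\<^sup>2)"
    by (simp add: L2_set_def sum.cartesian_product case_prod_unfold)
  finally have "cmod (\<Sum>i<n. \<Sum>j<n. of_real (F i j) * ?S i j) \<le>
      sqrt (\<Sum>i<n. \<Sum>j<n. (F i j)\<^sup>2) * sqrt (\<Sum>i<n. \<Sum>j<n. (cmod (?S i j))\<^sup>2)" .
  moreover have "(\<Sum>i<n. \<Sum>j<n. (cmod (?S i j))\<^sup>2) \<le> (\<Sum>i<n. 1\<^sup>2)"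
    by (intro sum_mono spectral_fun_row_norm[OF A b]) auto
  hence "sqrt (\<Sum>i<n. \<Sum>j<n. (F i j)\<^sup>2) * sqrt (\<Sum>i<n. \<Sum>j<n. (cmod (?S i j))\<^sup>2) \<le>
      sqrt (\<Sum>i<n. \<Sum>j<n. (F i j)\<^sup>2) * sqrt (real n)"
    by (intro mult_left_mono) (simp_all add: sum_nonneg)
  ultimately show ?thesis
    by (simp add: mult.commute)
qed

text \<open>
  The sign of \<open>A\<close> attains the bound in the duality.
\<close>

lemma kernel_energy_eq_pairing:
  assumes A: "symmetric_kernel A"
  shows "of_real (kernel_energy n A) =
           (\<Sum>i<n. \<Sum>j<n. of_real (A i j) * spectral_fun n A (\<lambda>x. of_real (sgn x)) i j)"
proof -
  have "(\<Sum>i<n. \<Sum>j<n. of_real (A i j) * spectral_fun n A (\<lambda>x. of_real (sgn x)) i j) =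
        (\<Sum>i<n. \<Sum>j<n. spectral_fun n A of_real i j * spectral_fun n A (\<lambda>x. of_real (sgn x)) j i)"
    by (intro sum.cong refl) (simp add: spectral_fun_id[OF A] spectral_fun_sym[of n A "\<lambda>x. of_real (sgn x)"])
  also have "\<dots> = (\<Sum>i<n. spectral_fun n A (\<lambda>x. of_real x * of_real (sgn x)) i i)"
    by (simp only: spectral_fun_mult[OF A])
  also have "\<dots> = of_real (\<Sum>k<n. \<bar>ev n A k\<bar>)"
    by (simp add: spectral_fun_trace[OF A] abs_sgn flip: of_real_mult)
  finally show ?thesis by (simp add: kernel_energy_eq[OF A])
qed

text \<open>
  Pairing with the sign of \<open>A\<close> is linear, so each part of the decomposition can be estimated on its own.
  The constant part is \<open>d\<close> times the quadratic form of the all-ones vector, whose squared length is \<open>n\<close>.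
  The factor \<open>a\<close> on the left allows the two matrices to exchange their places.
\<close>

lemma kernel_energy_le_perturbed:
  assumes A: "symmetric_kernel A" and B: "symmetric_kernel B"
    and dec: "\<And>i j. i < n \<Longrightarrow> j < n \<Longrightarrow> a * A i j = b * B i j + F i j + d"
    and pos: "0 \<le> a" "0 \<le> b"
  shows "a * kernel_energy n A \<le> b * kernel_energy n B + sqrt (real n) * sqrt (\<Sum>i<n. \<Sum>j<n. (F i j)\<^sup>2) + \<bar>d\<bar> * real n"
proof -
  let ?S = "spectral_fun n A (\<lambda>x. of_real (sgn x))"
  have contr: "cmod (of_real (sgn x)) \<le> 1" for x :: real
    by (simp add: sgn_if)
  have "of_real (a * kernel_energy n A) = (\<Sum>i<n. \<Sum>j<n. of_real (a * A i j) * ?S i j)"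
    by (simp add: kernel_energy_eq_pairing[OF A] sum_distrib_left mult_ac)
  also have "\<dots> = (\<Sum>i<n. \<Sum>j<n. of_real (b * B i j + F i j + d) * ?S i j)"
    by (intro sum.cong refl) (simp add: dec del: of_real_add of_real_mult)
  also have "\<dots> = of_real b * (\<Sum>i<n. \<Sum>j<n. of_real (B i j) * ?S i j) +
      (\<Sum>i<n. \<Sum>j<n. of_real (F i j) * ?S i j) + of_real d * (\<Sum>i<n. \<Sum>j<n. of_real 1 * ?S i j * of_real 1)"
    by (simp add: algebra_simps sum.distrib sum_distrib_left)
  finally have eq: "complex_of_real (a * kernel_energy n A) = \<dots>" .
  have tri: "cmod (of_real b * X + Y + of_real d * Z) \<le> b * cmod X + cmod Y + \<bar>d\<bar> * cmod Z" for X Y Z :: complex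
    using norm_triangle_ineq[of "of_real b * X + Y" "of_real d * Z"] norm_triangle_ineq[of "of_real b * X" Y] pos
    by (simp add: norm_mult)
  have "a * kernel_energy n A \<le> cmod (complex_of_real (a * kernel_energy n A))"
    by (simp only: norm_of_real)
  also have "\<dots> \<le> b * cmod (\<Sum>i<n. \<Sum>j<n. of_real (B i j) * ?S i j) +
      cmod (\<Sum>i<n. \<Sum>j<n. of_real (F i j) * ?S i j) + \<bar>d\<bar> * cmod (\<Sum>i<n. \<Sum>j<n. of_real 1 * ?S i j * of_real 1)"
    unfolding eq by (rule tri)
  also have "\<dots> \<le> b * kernel_energy n B + sqrt (real n) * sqrt (\<Sum>i<n. \<Sum>j<n. (F i j)\<^sup>2) + \<bar>d\<bar> * (\<Sum>i<n. 1\<^sup>2)"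
    by (intro add_mono mult_left_mono trace_pairing_le_energy norm_sum_pairing_le spectral_fun_quadratic_form A B contr)
       (use pos in auto)
  finally show ?thesis by simp
qed

lemma kernel_energy_perturbation:
  assumes A: "symmetric_kernel A" and B: "symmetric_kernel B"
    and dec: "\<And>i j. i < n \<Longrightarrow> j < n \<Longrightarrow> A i j = b * B i j + F i j + d"
    and pos: "0 \<le> b"
  shows "\<bar>kernel_energy n A - b * kernel_energy n B\<bar> \<le> sqrt (real n) * sqrt (\<Sum>i<n. \<Sum>j<n. (F i j)\<^sup>2) + \<bar>d\<bar> * real n"
proof -
  have "1 * kernel_energy n A \<le> b * kernel_energy n B + sqrt (real n) * sqrt (\<Sum>i<n. \<Sum>j<n. (F i j)\<^sup>2) + \<bar>d\<bar> * real n"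
    using dec pos by (intro kernel_energy_le_perturbed[OF A B]) auto
  moreover have "b * kernel_energy n B \<le> 1 * kernel_energy n A + sqrt (real n) * sqrt (\<Sum>i<n. \<Sum>j<n. (- F i j)\<^sup>2) + \<bar>- d\<bar> * real n"
    using dec pos by (intro kernel_energy_le_perturbed[OF B A]) auto
  ultimately show ?thesis by simp
qed

section \<open>The resolvent\<close>

text \<open>
  The resolvent at the point \<open>i t\<close> of the imaginary axis, and its normalised trace: the Stieltjes
  transform of the empirical spectral measure.
\<close>

definition resolvent :: "nat \<Rightarrow> (nat \<Rightarrow> nat \<Rightarrow> real) \<Rightarrow> real \<Rightarrow> nat \<Rightarrow> nat \<Rightarrow> complex" where
  "resolvent n A t = spectral_fun n A (\<lambda>x. 1 / (of_real x - \<i> * of_real t))"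

definition stieltjes :: "nat \<Rightarrow> (nat \<Rightarrow> nat \<Rightarrow> real) \<Rightarrow> real \<Rightarrow> complex" where
  "stieltjes n A t = (\<Sum>i<n. resolvent n A t i i) / of_nat n"

lemma resolvent_sym: "resolvent n A t i j = resolvent n A t j i"
  unfolding resolvent_def by (rule spectral_fun_sym)

lemma cmod_resolvent_fun_le:
  assumes "t > 0"
  shows "cmod (1 / (of_real x - \<i> * of_real t)) \<le> 1 / t"
proof -
  have "t \<le> cmod (of_real x - \<i> * of_real t)"
    using abs_Im_le_cmod[of "of_real x - \<i> * of_real t"] by simp
  thus ?thesis using assms by (simp add: norm_divide frac_le)
qed

lemma
  assumes A: "symmetric_kernel A" and t: "t > 0"
  shows resolvent_row_norm: "i < n \<Longrightarrow> (\<Sum>j<n. (cmod (resolvent n A t i j))\<^sup>2) \<le> (1 / t)\<^sup>2"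
    and resolvent_entry_norm: "i < n \<Longrightarrow> j < n \<Longrightarrow> cmod (resolvent n A t i j) \<le> 1 / t"
  unfolding resolvent_def using cmod_resolvent_fun_le[OF t]
  by (auto intro!: spectral_fun_row_norm[OF A] spectral_fun_entry_norm[OF A])

text \<open>
  The functional calculus of \<open>x / (x - i t) = 1 + i t / (x - i t)\<close>.
\<close>

lemma kernel_mult_resolvent:
  assumes A: "symmetric_kernel A" and t: "t > 0" and i: "i < n" "k < n"
  shows "(\<Sum>j<n. of_real (A i j) * resolvent n A t j k) = \<i> * of_real t * resolvent n A t i k + of_bool (i = k)"
proof -
  let ?g = "\<lambda>x. 1 / (complex_of_real x - \<i> * of_real t)"
  have nz: "complex_of_real x - \<i> * of_real t \<noteq> 0" for x
    using t by (auto simp: complex_eq_iff)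
  have "(\<Sum>j<n. of_real (A i j) * resolvent n A t j k) =
          (\<Sum>j<n. spectral_fun n A of_real i j * spectral_fun n A ?g j k)"
    by (intro sum.cong refl) (simp add: spectral_fun_id[OF A i(1)] resolvent_def)
  also have "\<dots> = spectral_fun n A (\<lambda>x. of_real x * ?g x) i k"
    by (rule spectral_fun_mult[OF A])
  also have "(\<lambda>x. of_real x * ?g x) = (\<lambda>x. \<i> * of_real t * ?g x + 1)"
    using nz by (auto simp: field_simps)
  also have "spectral_fun n A \<dots> i k = \<i> * of_real t * resolvent n A t i k + of_bool (i = k)"
    by (simp only: spectral_fun_add spectral_fun_scale spectral_fun_one[OF A i] resolvent_def)
  finally show ?thesis .
qed

text \<open>
  In \<open>G\<^sub>A (B - A) G\<^sub>B\<close> let \<open>B\<close> act on \<open>G\<^sub>B\<close> and \<open>A\<close> on \<open>G\<^sub>A\<close>; the terms with \<open>i t\<close> cancel.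
\<close>

lemma resolvent_identity:
  assumes A: "symmetric_kernel A" and B: "symmetric_kernel B" and t: "t > 0" and i: "i < n" "j < n"
  shows "resolvent n A t i j - resolvent n B t i j =
           (\<Sum>k<n. \<Sum>l<n. resolvent n A t i k * of_real (B k l - A k l) * resolvent n B t l j)"
proof -
  let ?G = "resolvent n A t" and ?H = "resolvent n B t"
  have 1: "(\<Sum>k<n. \<Sum>l<n. ?G i k * of_real (B k l) * ?H l j) = \<i> * of_real t * (\<Sum>k<n. ?G i k * ?H k j) + ?G i j"
  proof -
    have "(\<Sum>k<n. \<Sum>l<n. ?G i k * of_real (B k l) * ?H l j) = (\<Sum>k<n. ?G i k * (\<Sum>l<n. of_real (B k l) * ?H l j))"
      by (simp add: sum_distrib_left mult_ac)
    also have "\<dots> = (\<Sum>k<n. \<i> * of_real t * (?G i k * ?H k j) + (if k = j then ?G i k else 0))"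
      by (intro sum.cong refl) (simp add: kernel_mult_resolvent[OF B t _ i(2)] algebra_simps)
    finally show ?thesis using i by (simp add: sum.distrib sum_distrib_left)
  qed
  have 2: "(\<Sum>k<n. \<Sum>l<n. ?G i k * of_real (A k l) * ?H l j) = \<i> * of_real t * (\<Sum>k<n. ?G i k * ?H k j) + ?H i j"
  proof -
    have GA: "?G i k * of_real (A k l) = of_real (A l k) * ?G k i" for k l
      using A resolvent_sym[of n A t i k] by (metis mult.commute symmetric_kernel_def)
    have "(\<Sum>k<n. \<Sum>l<n. ?G i k * of_real (A k l) * ?H l j) = (\<Sum>l<n. (\<Sum>k<n. of_real (A l k) * ?G k i) * ?H l j)"
      unfolding sum_distrib_right GA by (rule sum.swap)
    also have "\<dots> = (\<Sum>l<n. \<i> * of_real t * (?G i l * ?H l j) + (if l = i then ?H l j else 0))"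
      by (intro sum.cong refl) (simp add: kernel_mult_resolvent[OF A t _ i(1)] resolvent_sym[of n A t i] algebra_simps)
    finally show ?thesis using i by (simp add: sum.distrib sum_distrib_left)
  qed
  show ?thesis
    using 1 2 by (simp add: algebra_simps sum_subtractf)
qed

lemma sum_kernel_resolvent:
  assumes A: "symmetric_kernel A" and t: "t > 0" and n: "n > 0"
  shows "(\<Sum>i<n. \<Sum>j<n. of_real (A i j) * resolvent n A t i j) = of_nat n * (\<i> * of_real t * stieltjes n A t + 1)"
proof -
  have "(\<Sum>i<n. \<Sum>j<n. of_real (A i j) * resolvent n A t i j) = (\<Sum>i<n. \<i> * of_real t * resolvent n A t i i + 1)"
  proof (intro sum.cong refl)
    fix i assume "i \<in> {..<n}"
    thus "(\<Sum>j<n. of_real (A i j) * resolvent n A t i j) = \<i> * of_real t * resolvent n A t i i + 1"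
      using kernel_mult_resolvent[OF A t, of i n i] by (subst resolvent_sym) simp
  qed
  thus ?thesis using n
    by (simp add: stieltjes_def sum.distrib sum_distrib_left[symmetric] field_simps)
qed

lemma Im_stieltjes:
  assumes A: "symmetric_kernel A" and t: "t > 0"
  shows "Im (stieltjes n A t) = (\<Sum>k<n. t / ((ev n A k)\<^sup>2 + t\<^sup>2)) / real n"
proof -
  have "stieltjes n A t = (\<Sum>k<n. 1 / (of_real (ev n A k) - \<i> * of_real t)) / of_nat n"
    by (simp add: stieltjes_def resolvent_def spectral_fun_trace[OF A])
  moreover have "Im (1 / (of_real x - \<i> * of_real t)) = t / (x\<^sup>2 + t\<^sup>2)" for x
    by (simp add: Im_divide)
  ultimately show ?thesis by (simp add: Im_divide_of_nat)
qed

lemma sum_ev_squares: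
  assumes A: "symmetric_kernel A"
  shows "(\<Sum>k<n. (ev n A k)\<^sup>2) = (\<Sum>i<n. \<Sum>j<n. (A i j)\<^sup>2)"
proof -
  have "complex_of_real (\<Sum>i<n. \<Sum>j<n. (A i j)\<^sup>2) =
        (\<Sum>i<n. \<Sum>j<n. spectral_fun n A of_real i j * spectral_fun n A of_real j i)"
    unfolding of_real_sum using A
    by (intro sum.cong refl) (simp add: spectral_fun_id[OF A] power2_eq_square symmetric_kernel_def)
  also have "\<dots> = (\<Sum>i<n. spectral_fun n A (\<lambda>x. of_real x * of_real x) i i)"
    by (simp only: spectral_fun_mult[OF A])
  also have "\<dots> = of_real (\<Sum>k<n. (ev n A k)\<^sup>2)"
    by (simp add: spectral_fun_trace[OF A] power2_eq_square)
  finally show ?thesis by (simp only: of_real_eq_iff)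
qed

section \<open>Independent coins: integration by parts and variance\<close>

lemma finite_set_pmf_Pi_bool:
  assumes "finite I"
  shows "finite (set_pmf (Pi_pmf I False (\<lambda>_. bernoulli_pmf p)))"
proof (rule finite_subset[OF set_Pi_pmf_subset'[OF assms]])
  show "finite (PiE_dflt I False (set_pmf \<circ> (\<lambda>_. bernoulli_pmf p)))"
    using assms by (intro finite_PiE_dflt) (auto intro: finite_subset[OF subset_UNIV])
qed

lemma expectation_mono_finite:
  fixes f g :: "'a \<Rightarrow> real"
  assumes "finite (set_pmf M)" and "\<And>x. f x \<le> g x"
  shows "measure_pmf.expectation M f \<le> measure_pmf.expectation M g"
  using assms by (intro integral_mono integrable_measure_pmf_finite) auto

text \<open>
  Conditioning on all coins except \<open>e\<close>.
\<close>

lemma expectation_bernoulli_product_split: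
  fixes f :: "('a \<Rightarrow> bool) \<Rightarrow> 'b :: {banach, second_countable_topology}"
  assumes I: "finite I" "e \<in> I" and p: "0 \<le> p" "p \<le> 1"
  shows "measure_pmf.expectation (Pi_pmf I False (\<lambda>_. bernoulli_pmf p)) f =
           p *\<^sub>R measure_pmf.expectation (Pi_pmf (I - {e}) False (\<lambda>_. bernoulli_pmf p)) (\<lambda>w. f (w(e := True))) +
           (1 - p) *\<^sub>R measure_pmf.expectation (Pi_pmf (I - {e}) False (\<lambda>_. bernoulli_pmf p)) (\<lambda>w. f (w(e := False)))"
proof -
  let ?J = "Pi_pmf (I - {e}) False (\<lambda>_. bernoulli_pmf p)"
  have "Pi_pmf I False (\<lambda>_. bernoulli_pmf p) =
          bernoulli_pmf p \<bind> (\<lambda>y. map_pmf (\<lambda>w. w(e := y)) ?J)"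
    using Pi_pmf_insert'[of "I - {e}" e False "\<lambda>_. bernoulli_pmf p"] I
    by (simp add: insert_absorb map_pmf_def)
  hence "measure_pmf.expectation (Pi_pmf I False (\<lambda>_. bernoulli_pmf p)) f =
      (\<Sum>y\<in>UNIV. pmf (bernoulli_pmf p) y *\<^sub>R measure_pmf.expectation (map_pmf (\<lambda>w. w(e := y)) ?J) f)"
    using I finite_set_pmf_Pi_bool[of "I - {e}" p] by (simp only:, intro pmf_expectation_bind) auto
  thus ?thesis
    using p by (simp add: UNIV_bool)
qed

text \<open>
  Integration by parts for a Bernoulli variable. Averaging over the coin \<open>e\<close> alone gives the weights
  \<open>p (1 - p)\<close> and \<open>(1 - p) (- p)\<close> to the two values of \<open>f\<close>, that is, a multiple of their difference. Because
  the identity is exact, no expansion of \<open>f\<close> in the entry is needed.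
\<close>

lemma expectation_centered_bernoulli_mult:
  fixes f :: "('a \<Rightarrow> bool) \<Rightarrow> complex"
  assumes I: "finite I" "e \<in> I" and p: "0 \<le> p" "p \<le> 1"
  shows "measure_pmf.expectation (Pi_pmf I False (\<lambda>_. bernoulli_pmf p)) (\<lambda>w. of_real (of_bool (w e) - p) * f w) =
           of_real (p * (1 - p)) * measure_pmf.expectation (Pi_pmf I False (\<lambda>_. bernoulli_pmf p))
             (\<lambda>w. f (w(e := True)) - f (w(e := False)))"
proof -
  let ?J = "Pi_pmf (I - {e}) False (\<lambda>_. bernoulli_pmf p)"
  have int: "integrable ?J g" for g :: "_ \<Rightarrow> complex"
    using I by (intro integrable_measure_pmf_finite finite_set_pmf_Pi_bool) auto
  show ?thesis
    by (subst (1 2) expectation_bernoulli_product_split[OF I p])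
       (simp add: int Bochner_Integration.integral_diff scaleR_conv_of_real algebra_simps)
qed

text \<open>
  The variance splits along one coin \<open>e\<close>: the average \<open>g\<close> of \<open>f\<close> over that coin has the same mean and the
  same bounded differences in the other coins, and the conditional variance is \<open>p (1 - p) (f\<^sub>1 - f\<^sub>0)\<^sup>2\<close>.
\<close>

lemma efron_stein_bounded_differences:
  fixes f :: "('a \<Rightarrow> bool) \<Rightarrow> real" and c :: "'a \<Rightarrow> real"
  assumes I: "finite I" and p: "0 \<le> p" "p \<le> 1"
    and diff: "\<And>e w. e \<in> I \<Longrightarrow> \<bar>f (w(e := True)) - f (w(e := False))\<bar> \<le> c e"
  defines "M \<equiv> \<lambda>I. Pi_pmf I False (\<lambda>_. bernoulli_pmf p)"
  shows "measure_pmf.expectation (M I) (\<lambda>w. (f w - measure_pmf.expectation (M I) f)\<^sup>2) \<le> (\<Sum>e\<in>I. (c e)\<^sup>2)"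
  using I diff
proof (induction I arbitrary: f rule: finite_induct)
  case empty
  show ?case by (simp add: M_def)
next
  case (insert e J)
  define f1 f0 where "f1 w = f (w(e := True))" and "f0 w = f (w(e := False))" for w
  define g where "g w = p * f1 w + (1 - p) * f0 w" for w
  have int: "integrable (M J) h" for h :: "_ \<Rightarrow> real"
    using insert.hyps(1) unfolding M_def by (intro integrable_measure_pmf_finite finite_set_pmf_Pi_bool)
  have split: "measure_pmf.expectation (M (insert e J)) h =
      measure_pmf.expectation (M J) (\<lambda>w. p * h (w(e := True)) + (1 - p) * h (w(e := False)))" for h :: "_ \<Rightarrow> real"
    using expectation_bernoulli_product_split[of "insert e J" e p h] insert.hyps p int
    by (simp add: M_def Bochner_Integration.integral_add)
  define m where "m = measure_pmf.expectation (M (insert e J)) f"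
  have m: "m = measure_pmf.expectation (M J) g"
    by (simp add: m_def split g_def[abs_def] f1_def f0_def)
  have d: "\<bar>f1 w - f0 w\<bar> \<le> c e" for w
    unfolding f1_def f0_def by (rule insert.prems) simp
  have "\<bar>g (w(k := True)) - g (w(k := False))\<bar> \<le> c k" if k: "k \<in> J" for k w
  proof -
    have ke: "k \<noteq> e" using k insert.hyps by auto
    have "g (w(k := True)) - g (w(k := False)) =
        p * (f ((w(e := True))(k := True)) - f ((w(e := True))(k := False))) +
        (1 - p) * (f ((w(e := False))(k := True)) - f ((w(e := False))(k := False)))"
      using ke by (simp add: g_def f1_def f0_def fun_upd_twist[of k e] algebra_simps)
    also have "\<bar>\<dots>\<bar> \<le> p * c k + (1 - p) * c k"
      using p k unfolding abs_mult[symmetric]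
      by (intro order.trans[OF abs_triangle_ineq] add_mono)
         (auto simp: abs_mult intro!: mult_left_mono insert.prems)
    finally show ?thesis by (simp add: algebra_simps)
  qed
  from insert.IH[OF this]
  have IH: "measure_pmf.expectation (M J) (\<lambda>w. (g w - m)\<^sup>2) \<le> (\<Sum>e\<in>J. (c e)\<^sup>2)"
    by (simp add: m)
  have "measure_pmf.expectation (M (insert e J)) (\<lambda>w. (f w - m)\<^sup>2) =
          measure_pmf.expectation (M J) (\<lambda>w. (g w - m)\<^sup>2 + p * (1 - p) * (f1 w - f0 w)\<^sup>2)"
    unfolding split by (intro Bochner_Integration.integral_cong)
      (auto simp: g_def f1_def f0_def power2_eq_square algebra_simps)
  also have "\<dots> \<le> measure_pmf.expectation (M J) (\<lambda>w. (g w - m)\<^sup>2 + (c e)\<^sup>2)"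
  proof (intro expectation_mono_finite)
    fix w
    have "p * (1 - p) \<le> 1" using p by (intro mult_le_one) auto
    moreover have "(f1 w - f0 w)\<^sup>2 \<le> (c e)\<^sup>2"
      using d[of w] by (simp add: abs_le_square_iff[symmetric])
    ultimately have "p * (1 - p) * (f1 w - f0 w)\<^sup>2 \<le> 1 * (c e)\<^sup>2"
      using p by (intro mult_mono) auto
    thus "(g w - m)\<^sup>2 + p * (1 - p) * (f1 w - f0 w)\<^sup>2 \<le> (g w - m)\<^sup>2 + (c e)\<^sup>2" by simp
  qed (use insert.hyps in \<open>auto simp: M_def finite_set_pmf_Pi_bool\<close>)
  also have "\<dots> \<le> (\<Sum>e\<in>insert e J. (c e)\<^sup>2)"
    using IH insert.hyps by (simp add: int)
  finally show ?case unfolding m_def .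
qed

lemma markov_pmf:
  fixes f :: "'a \<Rightarrow> real"
  assumes "finite (set_pmf M)" and "\<epsilon> > 0"
  shows "measure_pmf.prob M {x. \<bar>f x\<bar> > \<epsilon>} \<le> measure_pmf.expectation M (\<lambda>x. \<bar>f x\<bar>) / \<epsilon>"
proof -
  have "measure_pmf.prob M {x. \<bar>f x\<bar> > \<epsilon>} = measure_pmf.expectation M (indicator {x. \<bar>f x\<bar> > \<epsilon>})"
    by simp
  also have "\<dots> \<le> measure_pmf.expectation M (\<lambda>x. \<bar>f x\<bar> / \<epsilon>)"
    using assms by (intro expectation_mono_finite) (auto simp: indicator_def)
  finally show ?thesis by simp
qed

text \<open>
  The variance of \<open>\<bar>f\<bar>\<close> is nonnegative.
\<close>

lemma expectation_abs_le_sqrt: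
  fixes f :: "'a \<Rightarrow> real"
  assumes "finite (set_pmf M)"
  shows "measure_pmf.expectation M (\<lambda>x. \<bar>f x\<bar>) \<le> sqrt (measure_pmf.expectation M (\<lambda>x. (f x)\<^sup>2))"
proof -
  have int: "integrable M g" for g :: "_ \<Rightarrow> real"
    using assms by (rule integrable_measure_pmf_finite)
  have "0 \<le> measure_pmf.variance M (\<lambda>x. \<bar>f x\<bar>)"
    by (rule measure_pmf.variance_positive)
  also have "\<dots> = measure_pmf.expectation M (\<lambda>x. (f x)\<^sup>2) - (measure_pmf.expectation M (\<lambda>x. \<bar>f x\<bar>))\<^sup>2"
    by (subst measure_pmf.variance_eq) (auto simp: int)
  finally show ?thesis
    by (intro real_le_rsqrt) simp
qed

section \<open>The self-consistent equation of the centred adjacency matrix\<close>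

lemma finite_all_edges: "finite (all_edges n)"
  by (rule finite_subset[of _ "Pow {1..n}"]) (auto simp: all_edges_def)

lemma edge_in_all_edges_iff: "{i + 1, j + 1} \<in> all_edges n \<longleftrightarrow> i < n \<and> j < n \<and> i \<noteq> j"
  by (auto simp: all_edges_def card_insert_if)

lemma card_all_edges_le: "card (all_edges n) \<le> n\<^sup>2"
proof -
  have "all_edges n \<subseteq> (\<lambda>(i, j). {i, j}) ` ({1..n} \<times> {1..n})"
    by (auto simp: all_edges_def card_2_iff image_iff)
  hence "card (all_edges n) \<le> card ({1..n} \<times> {1..n})"
    by (rule surj_card_le[rotated]) auto
  thus ?thesis by (simp add: power2_eq_square)
qed

text \<open>
  The entries \<open>(i, j)\<close> and \<open>(j, i)\<close> are the only ones affected by the flip of an edge.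
\<close>

lemma sum_two_entries:
  fixes f g :: "nat \<Rightarrow> complex"
  assumes "i < n" "j < n" "i \<noteq> j"
  shows "(\<Sum>k<n. \<Sum>l<n. f k * of_real (if (k = i \<and> l = j) \<or> (k = j \<and> l = i) then c else 0) * g l) =
           of_real c * (f i * g j + f j * g i)"
proof -
  have "(\<Sum>k<n. \<Sum>l<n. f k * of_real (if (k = i \<and> l = j) \<or> (k = j \<and> l = i) then c else 0) * g l) =
     (\<Sum>k<n. \<Sum>l<n. (if l = j then if k = i then of_real c * f i * g j else 0 else 0) +
                    (if l = i then if k = j then of_real c * f j * g i else 0 else 0))"
    using assms by (intro sum.cong refl) auto
  also have "\<dots> = of_real c * (f i * g j + f j * g i)"
    using assms by (simp add: sum.distrib algebra_simps)
  finally show ?thesis .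
qed

lemma norm_sum_mult_le_L2:
  fixes f g :: "nat \<Rightarrow> complex"
  assumes "(\<Sum>i<n. (cmod (f i))\<^sup>2) \<le> b\<^sup>2" "(\<Sum>i<n. (cmod (g i))\<^sup>2) \<le> b\<^sup>2" "b \<ge> 0"
  shows "cmod (\<Sum>i<n. f i * g i) \<le> b\<^sup>2"
proof -
  have "cmod (\<Sum>i<n. f i * g i) \<le> (\<Sum>i<n. \<bar>cmod (f i)\<bar> * \<bar>cmod (g i)\<bar>)"
    by (intro sum_norm_le) (simp add: norm_mult)
  also have "\<dots> \<le> L2_set (\<lambda>i. cmod (f i)) {..<n} * L2_set (\<lambda>i. cmod (g i)) {..<n}"
    by (rule L2_set_mult_ineq)
  also have "\<dots> \<le> b * b"
    using assms by (intro mult_mono) (auto simp: L2_set_def sum_nonneg intro!: real_le_lsqrt)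
  finally show ?thesis by (simp add: power2_eq_square)
qed

lemma norm_diff_mult_le:
  fixes x y :: complex
  assumes "cmod (x - x') \<le> d" "cmod (y - y') \<le> d" "cmod y \<le> b" "cmod x' \<le> b"
  shows "cmod (x * y - x' * y') \<le> 2 * (d * b)"
proof -
  have "0 \<le> d" "0 \<le> b" using assms norm_ge_zero order_trans by blast+
  have "x * y - x' * y' = (x - x') * y + x' * (y - y')" by (simp add: algebra_simps)
  also have "cmod \<dots> \<le> cmod (x - x') * cmod y + cmod x' * cmod (y - y')"
    by (metis norm_mult norm_triangle_ineq)
  also have "\<dots> \<le> d * b + b * d"
    using assms \<open>0 \<le> d\<close> \<open>0 \<le> b\<close> by (intro add_mono mult_mono) auto
  finally show ?thesis by (simp add: mult.commute)
qed

locale gnp =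
  fixes p :: real and n :: nat
  assumes p0: "0 < p" and p1: "p < 1" and n0: "n > 0"
begin

text \<open>
  The factor that gives the off-diagonal entries of the centred adjacency matrix variance \<open>1 / n\<close>.
\<close>

definition scale :: real where "scale = 1 / sqrt (real n * (p * (1 - p)))"

definition edge_pmf :: "(nat set \<Rightarrow> bool) pmf" where
  "edge_pmf = Pi_pmf (all_edges n) False (\<lambda>_. bernoulli_pmf p)"

text \<open>
  The centred and normalised adjacency matrix, as a function of the indicator \<open>w\<close> of the edge set.
\<close>

definition wigner :: "(nat set \<Rightarrow> bool) \<Rightarrow> nat \<Rightarrow> nat \<Rightarrow> real" where
  "wigner w i j = (if {i + 1, j + 1} \<in> all_edges n then scale * (of_bool (w {i + 1, j + 1}) - p) else 0)"

lemma scale_pos: "scale > 0"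
  using p0 p1 n0 by (simp add: scale_def)

lemma scale_sq: "scale\<^sup>2 * (p * (1 - p)) = 1 / real n"
  using p0 p1 n0 by (simp add: scale_def power_divide)

lemma symmetric_wigner: "symmetric_kernel (wigner w)"
  by (simp add: symmetric_kernel_def wigner_def insert_commute)

lemma abs_wigner_le: "\<bar>wigner w i j\<bar> \<le> scale"
  using scale_pos p0 p1 by (auto simp: wigner_def abs_mult)

lemma finite_set_edge_pmf: "finite (set_pmf edge_pmf)"
  unfolding edge_pmf_def by (intro finite_set_pmf_Pi_bool finite_all_edges)

lemma integrable_edge_pmf: "integrable edge_pmf (f :: _ \<Rightarrow> 'b :: {banach, second_countable_topology})"
  by (intro integrable_measure_pmf_finite finite_set_edge_pmf)

abbreviation G :: "real \<Rightarrow> (nat set \<Rightarrow> bool) \<Rightarrow> nat \<Rightarrow> nat \<Rightarrow> complex" where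
  "G t w \<equiv> resolvent n (wigner w) t"

abbreviation s :: "real \<Rightarrow> (nat set \<Rightarrow> bool) \<Rightarrow> complex" where
  "s t w \<equiv> stieltjes n (wigner w) t"

definition mean :: "real \<Rightarrow> complex" where
  "mean t = measure_pmf.expectation edge_pmf (s t)"

lemma wigner_flip:
  assumes "i < n" "j < n" "i \<noteq> j"
  defines "e \<equiv> {i + 1, j + 1}"
  shows "wigner (w(e := False)) k l - wigner (w(e := True)) k l =
           (if (k = i \<and> l = j) \<or> (k = j \<and> l = i) then - scale else 0)"
proof (cases "{k + 1, l + 1} = e")
  case True
  hence "(k = i \<and> l = j) \<or> (k = j \<and> l = i)"
    by (auto simp: e_def doubleton_eq_iff)
  moreover have "{k + 1, l + 1} \<in> all_edges n"
    using True assms by (simp only: e_def edge_in_all_edges_iff) simp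
  ultimately show ?thesis unfolding wigner_def True by (simp add: algebra_simps)
next
  case False
  hence "\<not> ((k = i \<and> l = j) \<or> (k = j \<and> l = i))"
    by (auto simp: e_def)
  moreover have "wigner (w(e := False)) k l - wigner (w(e := True)) k l = 0"
    using False by (simp add: wigner_def)
  ultimately show ?thesis by (simp only: if_False)
qed

context
  fixes t :: real assumes t: "t > 0"
begin

lemma G_entry: "i < n \<Longrightarrow> j < n \<Longrightarrow> cmod (G t w i j) \<le> 1 / t"
  by (rule resolvent_entry_norm[OF symmetric_wigner t])

lemma G_row: "i < n \<Longrightarrow> (\<Sum>j<n. (cmod (G t w i j))\<^sup>2) \<le> (1 / t)\<^sup>2"
  by (rule resolvent_row_norm[OF symmetric_wigner t])

text \<open>
  Flipping an edge is a perturbation of rank two, which the resolvent identity resolves exactly.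
\<close>

lemma G_flip:
  assumes ij: "i < n" "j < n" "i \<noteq> j" and uv: "u < n" "v < n"
  defines "e \<equiv> {i + 1, j + 1}"
  shows "G t (w(e := True)) u v - G t (w(e := False)) u v =
           - of_real scale * (G t (w(e := True)) u i * G t (w(e := False)) j v +
                              G t (w(e := True)) u j * G t (w(e := False)) i v)"
  unfolding resolvent_identity[OF symmetric_wigner symmetric_wigner t uv] e_def wigner_flip[OF ij]
  by (subst sum_two_entries[OF ij]) simp

lemma G_flip_norm:
  assumes ij: "i < n" "j < n" "i \<noteq> j" and uv: "u < n" "v < n"
  defines "e \<equiv> {i + 1, j + 1}"
  shows "cmod (G t (w(e := True)) u v - G t (w(e := False)) u v) \<le> 2 * scale / t\<^sup>2"
proof -
  have *: "cmod (G t w1 a b * G t w2 c d) \<le> 1 / t * (1 / t)" if "a < n" "b < n" "c < n" "d < n" for w1 w2 a b c d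
    unfolding norm_mult using that t by (intro mult_mono G_entry) auto
  have "cmod (G t (w(e := True)) u v - G t (w(e := False)) u v) \<le> scale * (1 / t * (1 / t) + 1 / t * (1 / t))"
    unfolding e_def G_flip[OF ij uv] norm_mult norm_minus_cancel norm_of_real
    using scale_pos ij uv
    by (intro mult_mono order.trans[OF norm_triangle_ineq] add_mono *) auto
  thus ?thesis by (simp add: power2_eq_square mult.commute)
qed

text \<open>
  One of the two values of the coin is the present one, so this is either trivial or the previous bound.
\<close>

lemma G_close_to_flip:
  assumes ij: "i < n" "j < n" "i \<noteq> j" and uv: "u < n" "v < n"
  defines "e \<equiv> {i + 1, j + 1}"
  shows "cmod (G t (w(e := b)) u v - G t w u v) \<le> 2 * scale / t\<^sup>2"
proof -
  let ?g = "\<lambda>b. G t (w(e := b)) u v"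
  have flip: "cmod (?g True - ?g False) \<le> 2 * scale / t\<^sup>2"
    unfolding e_def by (rule G_flip_norm[OF ij uv])
  have "w(e := w e) = w" by (rule fun_upd_triv)
  hence "cmod (?g b - G t w u v) = cmod (?g b - ?g (w e))" by (simp only:)
  also have "\<dots> \<le> cmod (?g True - ?g False)"
    by (cases b; cases "w e"; simp only: norm_minus_commute order.refl diff_self norm_zero norm_ge_zero)
  finally show ?thesis using flip by linarith
qed

text \<open>
  Summed over the diagonal, each rank-one term is an inner product of two rows of resolvents and therefore
  still bounded by \<open>1 / t\<^sup>2\<close>. Normalisation then gains the factor \<open>1 / n\<close> over a single entry.
\<close>

lemma s_flip_norm:
  assumes ij: "i < n" "j < n" "i \<noteq> j"
  defines "e \<equiv> {i + 1, j + 1}"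
  shows "cmod (s t (w(e := True)) - s t (w(e := False))) \<le> 2 * scale / (real n * t\<^sup>2)"
proof -
  let ?G1 = "G t (w(e := True))" and ?G0 = "G t (w(e := False))"
  have *: "cmod (\<Sum>u<n. ?G1 u a * ?G0 b u) \<le> (1 / t)\<^sup>2" if "a < n" "b < n" for a b
    using that t G_row[of a "w(e := True)"] G_row[of b "w(e := False)"]
    by (intro norm_sum_mult_le_L2) (auto simp: resolvent_sym[of n _ t _ a])
  have "s t (w(e := True)) - s t (w(e := False)) = (\<Sum>u<n. ?G1 u u - ?G0 u u) / of_nat n"
    by (simp add: stieltjes_def sum_subtractf diff_divide_distrib)
  also have "(\<Sum>u<n. ?G1 u u - ?G0 u u) =
      (\<Sum>u<n. - of_real scale * (?G1 u i * ?G0 j u + ?G1 u j * ?G0 i u))"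
    unfolding e_def by (intro sum.cong refl G_flip[OF ij]) auto
  also have "\<dots> = - of_real scale * ((\<Sum>u<n. ?G1 u i * ?G0 j u) + (\<Sum>u<n. ?G1 u j * ?G0 i u))"
    by (simp add: sum_distrib_left sum.distrib algebra_simps sum_negf sum_subtractf)
  also have "cmod (\<dots> / of_nat n) \<le> scale * ((1 / t)\<^sup>2 + (1 / t)\<^sup>2) / real n"
    unfolding norm_divide norm_mult norm_minus_cancel norm_of_real norm_of_nat
    using scale_pos ij
    by (intro divide_right_mono mult_mono order.trans[OF norm_triangle_ineq] add_mono *) auto
  also have "\<dots> = 2 * scale / (real n * t\<^sup>2)"
    by (simp add: power_divide mult.commute)
  finally show ?thesis .
qed

text \<open>
  Efron-Stein with at most \<open>n\<^sup>2\<close> edges, for the real and the imaginary part separately.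
\<close>

lemma variance_s:
  "measure_pmf.expectation edge_pmf (\<lambda>w. (cmod (s t w - mean t))\<^sup>2) \<le> 8 * scale\<^sup>2 / t ^ 4"
proof -
  let ?c = "2 * scale / (real n * t\<^sup>2)"
  have edge: "\<exists>i j. i < n \<and> j < n \<and> i \<noteq> j \<and> e = {i + 1, j + 1}" if e: "e \<in> all_edges n" for e
  proof -
    from e obtain x y where xy: "e = {x, y}" "x \<noteq> y" by (auto simp: all_edges_def card_2_iff)
    with e have "x \<in> {1..n}" "y \<in> {1..n}" by (auto simp: all_edges_def)
    thus ?thesis using xy by (intro exI[of _ "x - 1"] exI[of _ "y - 1"]) auto
  qed
  have card: "(\<Sum>e\<in>all_edges n. ?c\<^sup>2) \<le> 4 * scale\<^sup>2 / t ^ 4"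
  proof -
    have "(\<Sum>e\<in>all_edges n. ?c\<^sup>2) \<le> (real n)\<^sup>2 * ?c\<^sup>2"
      using card_all_edges_le[of n] by (simp add: mult_right_mono flip: of_nat_power)
    also have "\<dots> = 4 * scale\<^sup>2 / t ^ 4"
      using n0 t by (simp add: field_simps power2_eq_square eval_nat_numeral)
    finally show ?thesis .
  qed
  have var: "measure_pmf.expectation edge_pmf (\<lambda>w. (f (s t w) - measure_pmf.expectation edge_pmf (\<lambda>w. f (s t w)))\<^sup>2) \<le> 4 * scale\<^sup>2 / t ^ 4"
    if f: "\<And>x y. \<bar>f x - f y\<bar> \<le> cmod (x - y)" for f :: "complex \<Rightarrow> real"
  proof -
    have "measure_pmf.expectation edge_pmf (\<lambda>w. (f (s t w) - measure_pmf.expectation edge_pmf (\<lambda>w. f (s t w)))\<^sup>2) \<le> (\<Sum>e\<in>all_edges n. ?c\<^sup>2)"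
      unfolding edge_pmf_def
    proof (rule efron_stein_bounded_differences)
      fix e w assume "e \<in> all_edges n"
      then obtain i j where ij: "i < n" "j < n" "i \<noteq> j" "e = {i + 1, j + 1}" using edge by blast
      show "\<bar>f (s t (w(e := True))) - f (s t (w(e := False)))\<bar> \<le> ?c"
        using order.trans[OF f s_flip_norm[OF ij(1-3)]] ij(4) by simp
    qed (use p0 p1 finite_all_edges in auto)
    with card show ?thesis by linarith
  qed
  have Re: "measure_pmf.expectation edge_pmf (\<lambda>w. Re (s t w)) = Re (mean t)"
    and Im: "measure_pmf.expectation edge_pmf (\<lambda>w. Im (s t w)) = Im (mean t)"
    by (simp_all add: mean_def integrable_edge_pmf)
  have "measure_pmf.expectation edge_pmf (\<lambda>w. (cmod (s t w - mean t))\<^sup>2) =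
        measure_pmf.expectation edge_pmf (\<lambda>w. (Re (s t w) - Re (mean t))\<^sup>2) +
        measure_pmf.expectation edge_pmf (\<lambda>w. (Im (s t w) - Im (mean t))\<^sup>2)"
    by (simp add: cmod_power2 integrable_edge_pmf)
  also have "\<dots> \<le> 4 * scale\<^sup>2 / t ^ 4 + 4 * scale\<^sup>2 / t ^ 4"
  proof (intro add_mono)
    show "measure_pmf.expectation edge_pmf (\<lambda>w. (Re (s t w) - Re (mean t))\<^sup>2) \<le> 4 * scale\<^sup>2 / t ^ 4"
      using var[of Re] abs_Re_le_cmod unfolding Re minus_complex.simps(1)[symmetric] by blast
    show "measure_pmf.expectation edge_pmf (\<lambda>w. (Im (s t w) - Im (mean t))\<^sup>2) \<le> 4 * scale\<^sup>2 / t ^ 4"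
      using var[of Im] abs_Im_le_cmod unfolding Im minus_complex.simps(2)[symmetric] by blast
  qed
  finally show ?thesis by simp
qed

text \<open>
  The exact form of \<open>G\<^sub>i\<^sub>i G\<^sub>j\<^sub>j + G\<^sub>i\<^sub>j\<^sup>2\<close> left by integration by parts: in each product one factor belongs to the
  graph with the edge \<open>i j\<close>, the other to the graph without it.
\<close>

definition flip_product :: "nat \<Rightarrow> nat \<Rightarrow> (nat set \<Rightarrow> bool) \<Rightarrow> complex" where
  "flip_product i j w =
     (let e = {i + 1, j + 1}; G1 = G t (w(e := True)); G0 = G t (w(e := False))
      in G1 i i * G0 j j + G1 i j * G0 i j)"

lemma expectation_wigner_mult_G:
  assumes ij: "i < n" "j < n" "i \<noteq> j"
  shows "measure_pmf.expectation edge_pmf (\<lambda>w. of_real (wigner w i j) * G t w i j) =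
           - measure_pmf.expectation edge_pmf (flip_product i j) / of_nat n"
proof -
  let ?e = "{i + 1, j + 1}"
  have e: "?e \<in> all_edges n" using ij by (simp only: edge_in_all_edges_iff) simp
  have "measure_pmf.expectation edge_pmf (\<lambda>w. of_real (wigner w i j) * G t w i j) =
        of_real scale * measure_pmf.expectation edge_pmf (\<lambda>w. of_real (of_bool (w ?e) - p) * G t w i j)"
    unfolding wigner_def using e by (simp add: mult.assoc del: of_real_diff)
  also have "\<dots> = of_real (scale * (p * (1 - p))) * measure_pmf.expectation edge_pmf
      (\<lambda>w. G t (w(?e := True)) i j - G t (w(?e := False)) i j)"
    unfolding edge_pmf_def using p0 p1 finite_all_edges e
    by (subst expectation_centered_bernoulli_mult) (auto simp: mult.assoc)
  also have "(\<lambda>w. G t (w(?e := True)) i j - G t (w(?e := False)) i j) = (\<lambda>w. - of_real scale * flip_product i j w)"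
    by (intro ext) (simp only: G_flip[OF ij ij(1,2)] flip_product_def Let_def)
  also have "of_real (scale * (p * (1 - p))) * measure_pmf.expectation edge_pmf \<dots> =
      - of_real (scale\<^sup>2 * (p * (1 - p))) * measure_pmf.expectation edge_pmf (flip_product i j)"
    by (simp add: power2_eq_square algebra_simps)
  also have "\<dots> = - measure_pmf.expectation edge_pmf (flip_product i j) / of_nat n"
    unfolding scale_sq by simp
  finally show ?thesis .
qed

text \<open>
  Replacing the flipped resolvents by the present one costs \<open>O (scale)\<close> per pair. The terms \<open>G\<^sub>i\<^sub>j\<^sup>2\<close> and the
  missing diagonal contribute only \<open>O (n)\<close> in total, by the bound on the rows. What is left is \<open>(n s)\<^sup>2\<close>.
\<close>

lemma sum_flip_product_close:
  "cmod ((\<Sum>i<n. \<Sum>j<n. if i = j then 0 else flip_product i j w) - (of_nat n * s t w)\<^sup>2)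
     \<le> 8 * scale * (real n)\<^sup>2 / t ^ 3 + 2 * real n / t\<^sup>2"
proof -
  let ?d = "2 * (2 * scale / t\<^sup>2 * (1 / t))"
  have d0: "0 \<le> ?d" using scale_pos t by simp
  \<comment> \<open>The two contributions \<open>?d\<close> come from the two products in \<open>flip_product\<close>.\<close>
  have 1: "cmod ((if i = j then 0 else flip_product i j w) - G t w i i * G t w j j) \<le>
          2 * ?d + (cmod (G t w i j))\<^sup>2 + (if i = j then (1 / t)\<^sup>2 else 0)" if ij: "i < n" "j < n" for i j
  proof (cases "i = j")
    case True
    have "cmod (G t w i i * G t w i i) \<le> 1 / t * (1 / t)"
      unfolding norm_mult using ij t by (intro mult_mono G_entry) auto
    thus ?thesis using True d0 by (simp add: power2_eq_square add_increasing)
  next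
    case False
    let ?e = "{i + 1, j + 1}"
    let ?G1 = "G t (w(?e := True))" and ?G0 = "G t (w(?e := False))"
    note close = G_close_to_flip[OF ij False]
    have a: "cmod (?G1 i i * ?G0 j j - G t w i i * G t w j j) \<le> ?d"
      using ij by (intro norm_diff_mult_le close G_entry) auto
    have b: "cmod (?G1 i j * ?G0 i j - G t w i j * G t w i j) \<le> ?d"
      using ij by (intro norm_diff_mult_le close G_entry) auto
    have eq: "flip_product i j w - G t w i i * G t w j j =
        (?G1 i i * ?G0 j j - G t w i i * G t w j j) + (?G1 i j * ?G0 i j - G t w i j * G t w i j) + (G t w i j)\<^sup>2"
      by (simp add: flip_product_def Let_def power2_eq_square)
    have "cmod (flip_product i j w - G t w i i * G t w j j) \<le> ?d + ?d + (cmod (G t w i j))\<^sup>2"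
      unfolding eq norm_power[symmetric] by (intro order.trans[OF norm_triangle_ineq] add_mono a b order.refl)
    thus ?thesis using False by (simp add: ac_simps)
  qed
  have "(of_nat n * s t w)\<^sup>2 = (\<Sum>i<n. \<Sum>j<n. G t w i i * G t w j j)"
    using n0 by (simp add: stieltjes_def power2_eq_square sum_product)
  hence "cmod ((\<Sum>i<n. \<Sum>j<n. if i = j then 0 else flip_product i j w) - (of_nat n * s t w)\<^sup>2) =
      cmod (\<Sum>i<n. \<Sum>j<n. (if i = j then 0 else flip_product i j w) - G t w i i * G t w j j)"
    by (simp add: sum_subtractf)
  also have "\<dots> \<le> (\<Sum>i<n. \<Sum>j<n. 2 * ?d + (cmod (G t w i j))\<^sup>2 + (if i = j then (1 / t)\<^sup>2 else 0))"
    using 1 by (intro sum_norm_le) auto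
  also have "\<dots> = (\<Sum>i<n. real n * (2 * ?d) + (\<Sum>j<n. (cmod (G t w i j))\<^sup>2) + (1 / t)\<^sup>2)"
    by (intro sum.cong refl) (simp add: sum.distrib)
  also have "\<dots> \<le> (\<Sum>i<n. real n * (2 * ?d) + (1 / t)\<^sup>2 + (1 / t)\<^sup>2)"
    by (intro sum_mono add_mono G_row) auto
  also have "\<dots> = 8 * scale * (real n)\<^sup>2 / t ^ 3 + 2 * real n / t\<^sup>2"
    using t by (simp add: field_simps power2_eq_square eval_nat_numeral)
  finally show ?thesis .
qed

text \<open>
  The self-consistent equation: the expected trace of \<open>X G = i t G + 1\<close>, computed by integration by parts.
\<close>

lemma mean_s_squared:
  "cmod (\<i> * of_real t * mean t + 1 + measure_pmf.expectation edge_pmf (\<lambda>w. (s t w)\<^sup>2))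
     \<le> 8 * scale / t ^ 3 + 2 / (real n * t\<^sup>2)"
proof -
  let ?E = "\<lambda>f. measure_pmf.expectation edge_pmf f :: complex"
  let ?R = "\<lambda>w. (\<Sum>i<n. \<Sum>j<n. if i = j then 0 else flip_product i j w)"
  have "of_nat n * (\<i> * of_real t * mean t + 1) = ?E (\<lambda>w. of_nat n * (\<i> * of_real t * s t w + 1))"
    by (simp add: mean_def integrable_edge_pmf)
  also have "\<dots> = ?E (\<lambda>w. \<Sum>i<n. \<Sum>j<n. of_real (wigner w i j) * G t w i j)"
    by (simp add: sum_kernel_resolvent[OF symmetric_wigner t n0])
  also have "\<dots> = (\<Sum>i<n. \<Sum>j<n. ?E (\<lambda>w. of_real (wigner w i j) * G t w i j))"
    by (simp add: Bochner_Integration.integral_sum integrable_edge_pmf)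
  also have "\<dots> = (\<Sum>i<n. \<Sum>j<n. - ?E (\<lambda>w. if i = j then 0 else flip_product i j w) / of_nat n)"
  proof (intro sum.cong refl)
    fix i j assume "i \<in> {..<n}" "j \<in> {..<n}"
    thus "?E (\<lambda>w. of_real (wigner w i j) * G t w i j) = - ?E (\<lambda>w. if i = j then 0 else flip_product i j w) / of_nat n"
      using expectation_wigner_mult_G[of i j] by (cases "i = j") (simp_all add: wigner_def all_edges_def)
  qed
  also have "\<dots> = - ?E ?R / of_nat n"
    by (simp add: Bochner_Integration.integral_sum integrable_edge_pmf sum_negf sum_divide_distrib)
  finally have eq: "of_nat n * (\<i> * of_real t * mean t + 1) = - ?E ?R / of_nat n" .
  define D where "D = ?E (\<lambda>w. ?R w - (of_nat n * s t w)\<^sup>2)"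
  have "\<i> * of_real t * mean t + 1 + ?E (\<lambda>w. (s t w)\<^sup>2) = - D / (of_nat n)\<^sup>2" (is "_ = ?rhs")
  proof -
    have "D = ?E ?R - (of_nat n)\<^sup>2 * ?E (\<lambda>w. (s t w)\<^sup>2)"
      by (simp add: D_def integrable_edge_pmf power_mult_distrib)
    moreover have "?E ?R = - (of_nat n)\<^sup>2 * (\<i> * of_real t * mean t + 1)"
      using eq n0 by (simp add: field_simps power2_eq_square)
    ultimately have "D = - ((of_nat n)\<^sup>2 * (\<i> * of_real t * mean t + 1 + ?E (\<lambda>w. (s t w)\<^sup>2)))"
      by (simp add: algebra_simps)
    thus ?thesis using n0 by simp
  qed
  also have "?rhs = - ?E (\<lambda>w. ?R w - (of_nat n * s t w)\<^sup>2) / (of_nat n)\<^sup>2" by (simp only: D_def)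
  also have "cmod \<dots> \<le> (8 * scale * (real n)\<^sup>2 / t ^ 3 + 2 * real n / t\<^sup>2) / (real n)\<^sup>2"
  proof -
    have "cmod (?E (\<lambda>w. ?R w - (of_nat n * s t w)\<^sup>2)) \<le>
        measure_pmf.expectation edge_pmf (\<lambda>w. cmod (?R w - (of_nat n * s t w)\<^sup>2))"
      by (rule integral_norm_bound)
    also have "\<dots> \<le> measure_pmf.expectation edge_pmf (\<lambda>w. 8 * scale * (real n)\<^sup>2 / t ^ 3 + 2 * real n / t\<^sup>2)"
      by (intro expectation_mono_finite finite_set_edge_pmf sum_flip_product_close)
    finally show ?thesis
      by (simp add: norm_divide norm_power divide_right_mono)
  qed
  also have "\<dots> = 8 * scale / t ^ 3 + 2 / (real n * t\<^sup>2)"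
    using n0 by (simp add: field_simps power2_eq_square)
  finally show ?thesis .
qed

end

end

section \<open>The energy of the centred adjacency matrix\<close>

text \<open>
  The Stieltjes transform of the semicircle law at \<open>i t\<close> is \<open>i\<close> times this number.
\<close>

definition semicircle_im :: "real \<Rightarrow> real" where
  "semicircle_im t = (sqrt (t\<^sup>2 + 4) - t) / 2"

text \<open>
  The additive constant makes the value at \<open>0\<close> vanish: \<open>4 / 3 = 4 * sqrt 4 / 6\<close>.
\<close>

definition semicircle_primitive :: "real \<Rightarrow> real" where
  "semicircle_primitive t = t + t ^ 3 / 6 + 4 / 3 - (t\<^sup>2 + 4) * sqrt (t\<^sup>2 + 4) / 6"

text \<open>
  The quadratic polynomial factors as the product of \<open>m\<close> minus the root in the upper half plane and \<open>m\<close>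
  minus the root in the lower one; the imaginary part of the latter root is at most \<open>-1\<close>, so the second factor has modulus at least \<open>1\<close>.
\<close>

lemma semicircle_equation_stable:
  fixes m :: complex
  assumes t: "t > 0" and Im: "Im m \<ge> 0" and K: "cmod (\<i> * of_real t * m + 1 + m\<^sup>2) \<le> K"
  shows "cmod (m - \<i> * of_real (semicircle_im t)) \<le> K"
proof -
  define r where "r = sqrt (t\<^sup>2 + 4)"
  have r2: "r * r = t * t + 4" by (simp add: r_def power2_eq_square)
  have "r \<ge> sqrt 4" unfolding r_def by (rule real_sqrt_le_mono) simp
  hence r: "r \<ge> 2" by simp
  let ?a = "m - \<i> * of_real (semicircle_im t)" and ?b = "m + \<i> * of_real ((r + t) / 2)"
  have im: "semicircle_im t = (r - t) / 2" by (simp add: semicircle_im_def r_def)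
  \<comment> \<open>\<open>- i (r + t) / 2\<close> is the other root of the quadratic equation.\<close>
  have "?a * ?b = \<i> * of_real t * m + 1 + m\<^sup>2"
    using r2 by (simp add: complex_eq_iff im power2_eq_square field_simps)
  hence "cmod ?a * cmod ?b \<le> K"
    using K by (metis norm_mult)
  moreover have "Im ?b = Im m + r / 2 + t / 2"
    by (simp add: add_divide_distrib)
  hence "1 \<le> \<bar>Im ?b\<bar>"
    using Im r t by linarith
  hence "1 \<le> cmod ?b"
    using abs_Im_le_cmod[of ?b] by linarith
  hence "cmod ?a * 1 \<le> cmod ?a * cmod ?b"
    by (intro mult_left_mono) auto
  ultimately show ?thesis by simp
qed

text \<open>
  As \<open>t\<close> runs from \<open>0\<close> to infinity this function grows from \<open>0\<close> to \<open>(\<pi> / 2) \<bar>x\<bar>\<close>. For \<open>x = 0\<close> it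
  vanishes identically, in accordance with the derivative.
\<close>

lemma has_real_derivative_abs_arctan:
  assumes "t > 0"
  shows "((\<lambda>t. \<bar>x\<bar> * arctan (t / \<bar>x\<bar>)) has_real_derivative x\<^sup>2 / (x\<^sup>2 + t\<^sup>2)) (at t within S)"
proof (cases "x = 0")
  case False
  have denom: "1 + (t / \<bar>x\<bar>)\<^sup>2 = (x\<^sup>2 + t\<^sup>2) / x\<^sup>2"
    using False by (simp add: power_divide add_divide_distrib)
  have eq: "\<bar>x\<bar> * (inverse (1 + (t / \<bar>x\<bar>)\<^sup>2) * (1 / \<bar>x\<bar>)) = x\<^sup>2 / (x\<^sup>2 + t\<^sup>2)"
    unfolding denom using False by simp
  show ?thesis
    unfolding eq[symmetric] using False
    by (auto intro!: derivative_eq_intros simp: mult.assoc)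
qed simp

lemma has_real_derivative_semicircle_primitive:
  "(semicircle_primitive has_real_derivative 1 - t * semicircle_im t) (at t within S)"
proof -
  define r where "r = sqrt (t\<^sup>2 + 4)"
  have r: "r > 0" and rr: "r * r = t\<^sup>2 + 4" by (simp_all add: r_def add_nonneg_pos)
  have pos: "t\<^sup>2 + 4 > 0" by (simp add: add_nonneg_pos)
  have "(semicircle_primitive has_real_derivative
          1 + 3 * t\<^sup>2 / 6 - (2 * t * r + (t\<^sup>2 + 4) * (inverse r / 2 * (2 * t))) / 6) (at t within S)"
    unfolding semicircle_primitive_def[abs_def] r_def using pos
    by (auto intro!: derivative_eq_intros)
  also have "1 + 3 * t\<^sup>2 / 6 - (2 * t * r + (t\<^sup>2 + 4) * (inverse r / 2 * (2 * t))) / 6 = 1 - t * semicircle_im t"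
    using r unfolding rr[symmetric] semicircle_im_def
    by (simp add: r_def[symmetric] field_simps power2_eq_square)
  finally show ?thesis .
qed

lemma semicircle_primitive_at_top: "(semicircle_primitive \<longlongrightarrow> 4 / 3) at_top"
  unfolding semicircle_primitive_def[abs_def] by real_asymp

lemma semicircle_primitive_at_0: "(semicircle_primitive \<longlongrightarrow> 0) (at_right 0)"
  unfolding semicircle_primitive_def[abs_def] by real_asymp

lemma abs_arctan_near_limit:
  fixes x :: real
  assumes T: "T > 0"
  shows "\<bar>pi / 2 * \<bar>x\<bar> - \<bar>x\<bar> * arctan (T / \<bar>x\<bar>)\<bar> \<le> x\<^sup>2 / T"
proof (cases "x = 0")
  case False
  hence pos: "\<bar>x\<bar> / T > 0" using T by simp
  have "arctan (T / \<bar>x\<bar>) = pi / 2 - arctan (\<bar>x\<bar> / T)"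
    using arctan_inverse[of "\<bar>x\<bar> / T"] pos False T by (simp add: sgn_if)
  hence "pi / 2 * \<bar>x\<bar> - \<bar>x\<bar> * arctan (T / \<bar>x\<bar>) = \<bar>x\<bar> * arctan (\<bar>x\<bar> / T)"
    by (simp only: right_diff_distrib) simp
  moreover have "0 \<le> \<bar>x\<bar> * arctan (\<bar>x\<bar> / T)"
    using pos by simp
  moreover have "\<bar>x\<bar> * arctan (\<bar>x\<bar> / T) \<le> \<bar>x\<bar> * (\<bar>x\<bar> / T)"
    using pos by (intro mult_left_mono arctan_le_self) auto
  ultimately show ?thesis by (simp add: power2_eq_square)
qed simp

context gnp
begin

text \<open>
  \<open>E (s\<^sup>2)\<close> differs from \<open>(E s)\<^sup>2\<close> by at most the variance, so the self-consistent equation becomes an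
  approximate quadratic equation for the mean, whose imaginary part is nonnegative.
\<close>

lemma mean_close:
  assumes t: "t > 0"
  shows "cmod (mean t - \<i> * of_real (semicircle_im t)) \<le>
           8 * scale / t ^ 3 + 2 / (real n * t\<^sup>2) + 8 * scale\<^sup>2 / t ^ 4"
proof (rule semicircle_equation_stable[OF t])
  let ?E = "\<lambda>f. measure_pmf.expectation edge_pmf f :: complex"
  have "0 \<le> Im (s t w)" for w
    unfolding Im_stieltjes[OF symmetric_wigner t] using t by (intro divide_nonneg_nonneg sum_nonneg) auto
  hence "0 \<le> measure_pmf.expectation edge_pmf (\<lambda>w. Im (s t w))"
    by (intro Bochner_Integration.integral_nonneg) auto
  thus "0 \<le> Im (mean t)"
    by (simp add: mean_def integrable_edge_pmf)
  have "?E (\<lambda>w. (s t w - mean t)\<^sup>2) = ?E (\<lambda>w. (s t w)\<^sup>2) - 2 * mean t * ?E (s t) + (mean t)\<^sup>2"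
    by (simp add: power2_diff integrable_edge_pmf algebra_simps)
  hence var: "?E (\<lambda>w. (s t w)\<^sup>2) = (mean t)\<^sup>2 + ?E (\<lambda>w. (s t w - mean t)\<^sup>2)"
    by (simp add: mean_def[symmetric] power2_eq_square algebra_simps)
  have "cmod (?E (\<lambda>w. (s t w - mean t)\<^sup>2)) \<le> measure_pmf.expectation edge_pmf (\<lambda>w. (cmod (s t w - mean t))\<^sup>2)"
    unfolding norm_power[symmetric] by (rule integral_norm_bound)
  also have "\<dots> \<le> 8 * scale\<^sup>2 / t ^ 4" by (rule variance_s[OF t])
  finally have V: "cmod (?E (\<lambda>w. (s t w - mean t)\<^sup>2)) \<le> 8 * scale\<^sup>2 / t ^ 4" .
  \<comment> \<open>The first summand is small by the self-consistent equation, the second by concentration.\<close>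
  have eq: "\<i> * of_real t * mean t + 1 + (mean t)\<^sup>2 =
      (\<i> * of_real t * mean t + 1 + ?E (\<lambda>w. (s t w)\<^sup>2)) - ?E (\<lambda>w. (s t w - mean t)\<^sup>2)"
    by (simp add: var)
  show "cmod (\<i> * of_real t * mean t + 1 + (mean t)\<^sup>2) \<le> 8 * scale / t ^ 3 + 2 / (real n * t\<^sup>2) + 8 * scale\<^sup>2 / t ^ 4"
    unfolding eq by (rule order.trans[OF norm_triangle_ineq4 add_mono[OF mean_s_squared[OF t] V]])
qed

lemma expected_s_close:
  assumes t: "t > 0"
  shows "measure_pmf.expectation edge_pmf (\<lambda>w. cmod (s t w - \<i> * of_real (semicircle_im t))) \<le>
           3 * scale / t\<^sup>2 + 8 * scale / t ^ 3 + 2 / (real n * t\<^sup>2) + 8 * scale\<^sup>2 / t ^ 4"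
proof -
  let ?K = "8 * scale / t ^ 3 + 2 / (real n * t\<^sup>2) + 8 * scale\<^sup>2 / t ^ 4"
  have "measure_pmf.expectation edge_pmf (\<lambda>w. cmod (s t w - \<i> * of_real (semicircle_im t))) \<le>
        measure_pmf.expectation edge_pmf (\<lambda>w. \<bar>cmod (s t w - mean t)\<bar> + ?K)"
  proof (intro expectation_mono_finite finite_set_edge_pmf)
    fix w
    show "cmod (s t w - \<i> * of_real (semicircle_im t)) \<le> \<bar>cmod (s t w - mean t)\<bar> + ?K"
      using norm_triangle_ineq[of "s t w - mean t" "mean t - \<i> * of_real (semicircle_im t)"] mean_close[OF t]
      by simp
  qed
  also have "\<dots> = measure_pmf.expectation edge_pmf (\<lambda>w. \<bar>cmod (s t w - mean t)\<bar>) + ?K"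
    by (simp add: integrable_edge_pmf del: abs_norm_cancel)
  also have "measure_pmf.expectation edge_pmf (\<lambda>w. \<bar>cmod (s t w - mean t)\<bar>) \<le>
      sqrt (measure_pmf.expectation edge_pmf (\<lambda>w. (cmod (s t w - mean t))\<^sup>2))"
    by (rule expectation_abs_le_sqrt[OF finite_set_edge_pmf])
  also have "\<dots> \<le> sqrt ((3 * scale / t\<^sup>2)\<^sup>2)"
  proof (rule real_sqrt_le_mono)
    have "8 * scale\<^sup>2 / t ^ 4 \<le> 9 * scale\<^sup>2 / t ^ 4"
      by (intro divide_right_mono mult_right_mono) auto
    also have "\<dots> = (3 * scale / t\<^sup>2)\<^sup>2"
      by (simp add: power_divide power_mult_distrib)
    finally show "measure_pmf.expectation edge_pmf (\<lambda>w. (cmod (s t w - mean t))\<^sup>2) \<le> (3 * scale / t\<^sup>2)\<^sup>2"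
      using variance_s[OF t] by linarith
  qed
  also have "sqrt ((3 * scale / t\<^sup>2)\<^sup>2) = 3 * scale / t\<^sup>2"
    using scale_pos by simp
  finally show ?thesis by simp
qed

text \<open>
  The constant in the error bound \<open>O (1 / sqrt n)\<close>; it comes from \<open>scale = c / sqrt n\<close> with
  \<open>c = 1 / sqrt (p (1 - p))\<close>.
\<close>

definition rate :: real where
  "rate = 11 / sqrt (p * (1 - p)) + 2 + 8 / (p * (1 - p))"

lemma expected_s_close_uniform:
  assumes d: "0 < d" "d \<le> 1" and t: "d \<le> t"
  shows "measure_pmf.expectation edge_pmf (\<lambda>w. cmod (s t w - \<i> * of_real (semicircle_im t))) \<le> rate / (d ^ 4 * sqrt (real n))"
proof -
  define c where "c = 1 / sqrt (p * (1 - p))"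
  have c: "c > 0" "c\<^sup>2 = 1 / (p * (1 - p))"
    using p0 p1 by (simp_all add: c_def power_divide)
  have rate: "rate = 11 * c + 2 + 8 * c\<^sup>2"
    unfolding c(2) by (simp add: rate_def c_def)
  have sc: "scale = c / sqrt (real n)"
    by (simp add: scale_def c_def real_sqrt_mult mult.commute)
  have t0: "t > 0" using d t by simp
  \<comment> \<open>Since \<open>d \<le> 1\<close>, the factor \<open>1 / d ^ 4\<close> bounds every negative power of \<open>t\<close> that occurs.\<close>
  have pw: "d ^ 4 \<le> t ^ k" if "k \<le> 4" for k
  proof -
    have "d ^ 4 \<le> d ^ k" using d that by (intro power_decreasing) auto
    also have "\<dots> \<le> t ^ k" using d t by (intro power_mono) auto
    finally show ?thesis .
  qed
  have n1: "sqrt (real n) \<ge> 1" using n0 by simp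
  have n2: "sqrt (real n) \<le> real n"
    using mult_left_mono[OF n1, of "sqrt (real n)"] by simp
  have le: "a / (sqrt (real n) * t ^ k) \<le> a / (sqrt (real n) * d ^ 4)" if "a \<ge> 0" "k \<le> 4" for a k
    using that d n0 pw[OF that(2)] t0 by (intro divide_left_mono mult_left_mono mult_pos_pos) auto
  have le': "a / (real n * t ^ k) \<le> a / (sqrt (real n) * d ^ 4)" if "a \<ge> 0" "k \<le> 4" for a k
  proof -
    have "a / (real n * t ^ k) \<le> a / (sqrt (real n) * t ^ k)"
      using that n0 t0 by (intro divide_left_mono mult_right_mono mult_pos_pos n2) auto
    also have "\<dots> \<le> a / (sqrt (real n) * d ^ 4)" by (rule le[OF that])
    finally show ?thesis .
  qed
  have "3 * scale / t\<^sup>2 + 8 * scale / t ^ 3 + 2 / (real n * t\<^sup>2) + 8 * scale\<^sup>2 / t ^ 4 =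
        3 * c / (sqrt (real n) * t\<^sup>2) + 8 * c / (sqrt (real n) * t ^ 3) + 2 / (real n * t\<^sup>2) + 8 * c\<^sup>2 / (real n * t ^ 4)"
    by (simp add: sc power_divide)
  also have "\<dots> \<le> 3 * c / (sqrt (real n) * d ^ 4) + 8 * c / (sqrt (real n) * d ^ 4) +
      2 / (sqrt (real n) * d ^ 4) + 8 * c\<^sup>2 / (sqrt (real n) * d ^ 4)"
    using c(1) by (intro add_mono le le') auto
  also have "\<dots> = rate / (d ^ 4 * sqrt (real n))"
    unfolding rate by (simp add: add_divide_distrib[symmetric] mult.commute[of "d ^ 4"])
  finally show ?thesis
    using expected_s_close[OF t0] by linarith
qed

text \<open>
  The spectral average of \<open>\<integral> x\<^sup>2 / (x\<^sup>2 + u\<^sup>2) du\<close> over \<open>0 < u < t\<close>; it approaches \<open>\<pi> / 2\<close> times the energy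
  divided by \<open>n\<close> as \<open>t\<close> grows.
\<close>

definition truncated_energy :: "(nat set \<Rightarrow> bool) \<Rightarrow> real \<Rightarrow> real" where
  "truncated_energy w t = (\<Sum>k<n. \<bar>ev n (wigner w) k\<bar> * arctan (t / \<bar>ev n (wigner w) k\<bar>)) / real n"

lemma has_real_derivative_truncated_energy:
  assumes t: "t > 0"
  shows "(truncated_energy w has_real_derivative 1 - t * Im (s t w)) (at t within S)"
proof -
  have pos: "x\<^sup>2 + t\<^sup>2 > 0" for x :: real using t by (simp add: add_nonneg_pos)
  have eq: "1 - t\<^sup>2 / (x\<^sup>2 + t\<^sup>2) = x\<^sup>2 / (x\<^sup>2 + t\<^sup>2)" for x :: real
  proof -
    have "x\<^sup>2 / (x\<^sup>2 + t\<^sup>2) + t\<^sup>2 / (x\<^sup>2 + t\<^sup>2) = 1"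
      unfolding add_divide_distrib[symmetric]
      by (rule divide_self) (rule less_imp_neq[OF pos, THEN not_sym])
    thus ?thesis by linarith
  qed
  have "1 - t * Im (s t w) = (\<Sum>k<n. 1 - t\<^sup>2 / ((ev n (wigner w) k)\<^sup>2 + t\<^sup>2)) / real n"
    using n0 unfolding Im_stieltjes[OF symmetric_wigner t]
    by (simp add: sum_subtractf sum_distrib_left power2_eq_square diff_divide_distrib)
  also have "\<dots> = (\<Sum>k<n. (ev n (wigner w) k)\<^sup>2 / ((ev n (wigner w) k)\<^sup>2 + t\<^sup>2)) / real n"
    by (simp add: eq)
  finally show ?thesis
    unfolding truncated_energy_def[abs_def]
    by (auto intro!: DERIV_cdivide DERIV_sum has_real_derivative_abs_arctan t)
qed

lemma truncated_energy_small:
  assumes d: "d \<ge> 0"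
  shows "0 \<le> truncated_energy w d \<and> truncated_energy w d \<le> d"
proof -
  have *: "0 \<le> \<bar>x\<bar> * arctan (d / \<bar>x\<bar>) \<and> \<bar>x\<bar> * arctan (d / \<bar>x\<bar>) \<le> d" for x
  proof (cases "x = 0")
    case False
    have "\<bar>x\<bar> * arctan (d / \<bar>x\<bar>) \<le> \<bar>x\<bar> * (d / \<bar>x\<bar>)"
      using d by (intro mult_left_mono arctan_le_self) auto
    thus ?thesis using False d by simp
  qed (use d in simp)
  have "(\<Sum>k<n. \<bar>ev n (wigner w) k\<bar> * arctan (d / \<bar>ev n (wigner w) k\<bar>)) \<le> (\<Sum>k<n. d)"
    using * by (intro sum_mono) auto
  thus ?thesis
    using n0 * by (auto simp: truncated_energy_def field_simps intro!: divide_nonneg_nonneg sum_nonneg)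
qed

text \<open>
  Truncation at \<open>T\<close> loses at most the mean square of the eigenvalues divided by \<open>T\<close>, and that mean square is
  bounded for every graph because the entries are.
\<close>

lemma truncated_energy_large:
  assumes T: "T > 0"
  shows "\<bar>pi / 2 * (kernel_energy n (wigner w) / real n) - truncated_energy w T\<bar> \<le> 1 / (p * (1 - p)) / T"
proof -
  have "(\<Sum>k<n. (ev n (wigner w) k)\<^sup>2) = (\<Sum>i<n. \<Sum>j<n. (wigner w i j)\<^sup>2)"
    by (rule sum_ev_squares[OF symmetric_wigner])
  also have "\<dots> \<le> (\<Sum>i<n. \<Sum>j<n. scale\<^sup>2)"
    using abs_wigner_le by (intro sum_mono) (metis abs_le_square_iff abs_of_pos scale_pos)
  also have "\<dots> = real n * (1 / (p * (1 - p)))"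
    using p0 p1 n0 by (simp add: scale_def power_divide)
  finally have sq: "(\<Sum>k<n. (ev n (wigner w) k)\<^sup>2) \<le> real n * (1 / (p * (1 - p)))" .
  have eq: "pi / 2 * (kernel_energy n (wigner w) / real n) - truncated_energy w T =
     (\<Sum>k<n. pi / 2 * \<bar>ev n (wigner w) k\<bar> - \<bar>ev n (wigner w) k\<bar> * arctan (T / \<bar>ev n (wigner w) k\<bar>)) / real n"
    by (simp add: truncated_energy_def kernel_energy_eq[OF symmetric_wigner] sum_subtractf sum_distrib_left diff_divide_distrib)
  have "\<bar>pi / 2 * (kernel_energy n (wigner w) / real n) - truncated_energy w T\<bar> \<le> (\<Sum>k<n. (ev n (wigner w) k)\<^sup>2 / T) / real n"
    unfolding eq abs_divide using abs_arctan_near_limit[OF T]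
    by (auto intro!: divide_right_mono order.trans[OF sum_abs] sum_mono)
  also have "\<dots> \<le> (real n * (1 / (p * (1 - p))) / T) / real n"
    unfolding sum_divide_distrib[symmetric] using sq T by (intro divide_right_mono) auto
  also have "\<dots> = 1 / (p * (1 - p)) / T" using n0 by simp
  finally show ?thesis .
qed

text \<open>
  Both sides of the comparison have explicit derivatives, \<open>1 - t Im s\<close> and \<open>1 - t semicircle_im t\<close>.
\<close>

lemma truncated_energy_increment:
  assumes d: "0 < d" "d \<le> T"
  shows "\<bar>(truncated_energy w T - semicircle_primitive T) - (truncated_energy w d - semicircle_primitive d)\<bar> \<le>
           integral {d..T} (\<lambda>t. t * \<bar>semicircle_im t - Im (s t w)\<bar>)"
    and "(\<lambda>t. t * \<bar>semicircle_im t - Im (s t w)\<bar>) integrable_on {d..T}"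
proof -
  let ?D = "\<lambda>t. truncated_energy w t - semicircle_primitive t"
  let ?f = "\<lambda>t. (1 - t * Im (s t w)) - (1 - t * semicircle_im t)"
  have ftc: "(?f has_integral ?D T - ?D d) {d..T}"
  proof (rule fundamental_theorem_of_calculus[OF d(2)])
    fix t assume "t \<in> {d..T}"
    hence t: "t > 0" using d by simp
    show "(?D has_vector_derivative ?f t) (at t within {d..T})"
      unfolding has_real_derivative_iff_has_vector_derivative[symmetric]
      by (intro DERIV_diff has_real_derivative_truncated_energy[OF t] has_real_derivative_semicircle_primitive)
  qed
  have "continuous_on {d..T} (\<lambda>t. t * \<bar>semicircle_im t - (\<Sum>k<n. t / ((ev n (wigner w) k)\<^sup>2 + t\<^sup>2)) / real n\<bar>)"
    unfolding semicircle_im_def using d n0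
    by (intro continuous_intros) (auto simp: add_nonneg_eq_0_iff)
  moreover have "t * \<bar>semicircle_im t - (\<Sum>k<n. t / ((ev n (wigner w) k)\<^sup>2 + t\<^sup>2)) / real n\<bar> =
      t * \<bar>semicircle_im t - Im (s t w)\<bar>" if "t \<in> {d..T}" for t
    using that d by (subst Im_stieltjes[OF symmetric_wigner]) auto
  ultimately have "continuous_on {d..T} (\<lambda>t. t * \<bar>semicircle_im t - Im (s t w)\<bar>)"
    by (rule continuous_on_eq)
  thus int: "(\<lambda>t. t * \<bar>semicircle_im t - Im (s t w)\<bar>) integrable_on {d..T}"
    by (rule integrable_continuous_real)
  have "norm (integral {d..T} ?f) \<le> integral {d..T} (\<lambda>t. t * \<bar>semicircle_im t - Im (s t w)\<bar>)"
  proof (rule integral_norm_bound_integral[OF has_integral_integrable[OF ftc] int])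
    fix t assume "t \<in> {d..T}"
    hence "\<bar>t * (semicircle_im t - Im (s t w))\<bar> = t * \<bar>semicircle_im t - Im (s t w)\<bar>"
      using d by (simp add: abs_mult)
    thus "norm (?f t) \<le> t * \<bar>semicircle_im t - Im (s t w)\<bar>"
      by (simp add: algebra_simps)
  qed
  thus "\<bar>?D T - ?D d\<bar> \<le> integral {d..T} (\<lambda>t. t * \<bar>semicircle_im t - Im (s t w)\<bar>)"
    unfolding integral_unique[OF ftc] by simp
qed

text \<open>
  The edge distribution has finite support, so the expectation is a finite sum and commutes with the integral.
\<close>

lemma expected_truncated_energy_increment:
  assumes d: "0 < d" "d \<le> 1" "1 \<le> T"
  shows "measure_pmf.expectation edge_pmf (\<lambda>w. \<bar>(truncated_energy w T - semicircle_primitive T) - (truncated_energy w d - semicircle_primitive d)\<bar>)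
           \<le> T\<^sup>2 * rate / (d ^ 4 * sqrt (real n))"
proof -
  let ?B = "rate / (d ^ 4 * sqrt (real n))"
  have expand: "measure_pmf.expectation edge_pmf f = (\<Sum>w\<in>set_pmf edge_pmf. pmf edge_pmf w * f w)" for f :: "_ \<Rightarrow> real"
    using finite_set_edge_pmf by (subst integral_measure_pmf[of "set_pmf edge_pmf"]) auto
  have dT: "d \<le> T" using d by simp
  note int = truncated_energy_increment(2)[OF d(1) dT]
  have int': "(\<lambda>t. \<Sum>w\<in>set_pmf edge_pmf. pmf edge_pmf w * (t * \<bar>semicircle_im t - Im (s t w)\<bar>)) integrable_on {d..T}"
    by (intro integrable_sum finite_set_edge_pmf integrable_on_mult_right int)
  have B0: "?B \<ge> 0"
    unfolding rate_def using p0 p1 d by (intro divide_nonneg_nonneg add_nonneg_nonneg) auto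
  have "measure_pmf.expectation edge_pmf (\<lambda>w. \<bar>(truncated_energy w T - semicircle_primitive T) - (truncated_energy w d - semicircle_primitive d)\<bar>)
      \<le> measure_pmf.expectation edge_pmf (\<lambda>w. integral {d..T} (\<lambda>t. t * \<bar>semicircle_im t - Im (s t w)\<bar>))"
    by (intro expectation_mono_finite finite_set_edge_pmf truncated_energy_increment(1) d(1) dT)
  also have "\<dots> = integral {d..T} (\<lambda>t. \<Sum>w\<in>set_pmf edge_pmf. pmf edge_pmf w * (t * \<bar>semicircle_im t - Im (s t w)\<bar>))"
    unfolding expand
    by (subst integral_sum) (auto intro!: finite_set_edge_pmf integrable_on_mult_right int)
  also have "\<dots> \<le> integral {d..T} (\<lambda>t. T * ?B)"
  proof (rule integral_le[OF int'])
    fix t assume t: "t \<in> {d..T}"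
    have "(\<Sum>w\<in>set_pmf edge_pmf. pmf edge_pmf w * (t * \<bar>semicircle_im t - Im (s t w)\<bar>)) =
        t * measure_pmf.expectation edge_pmf (\<lambda>w. \<bar>semicircle_im t - Im (s t w)\<bar>)"
      unfolding expand by (simp add: sum_distrib_left mult_ac)
    also have "\<dots> \<le> T * ?B"
    proof (intro mult_mono)
      have "measure_pmf.expectation edge_pmf (\<lambda>w. \<bar>semicircle_im t - Im (s t w)\<bar>) \<le>
            measure_pmf.expectation edge_pmf (\<lambda>w. cmod (s t w - \<i> * of_real (semicircle_im t)))"
      proof (intro expectation_mono_finite finite_set_edge_pmf)
        fix w
        show "\<bar>semicircle_im t - Im (s t w)\<bar> \<le> cmod (s t w - \<i> * of_real (semicircle_im t))"
          using abs_Im_le_cmod[of "s t w - \<i> * of_real (semicircle_im t)"] by simp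
      qed
      also have "\<dots> \<le> ?B" using t by (intro expected_s_close_uniform d) auto
      finally show "measure_pmf.expectation edge_pmf (\<lambda>w. \<bar>semicircle_im t - Im (s t w)\<bar>) \<le> ?B" .
    qed (use t d in auto)
    finally show "(\<Sum>w\<in>set_pmf edge_pmf. pmf edge_pmf w * (t * \<bar>semicircle_im t - Im (s t w)\<bar>)) \<le> T * ?B" .
  qed auto
  also have "\<dots> = (T - d) * (T * ?B)" using d by simp
  also have "\<dots> \<le> T * (T * ?B)" using d B0 by (intro mult_right_mono mult_nonneg_nonneg) auto
  finally show ?thesis by (simp add: power2_eq_square mult_ac)
qed

lemma expected_energy_error:
  assumes d: "0 < d" "d \<le> 1" "1 \<le> T"
  shows "measure_pmf.expectation edge_pmf (\<lambda>w. \<bar>kernel_energy n (wigner w) / real n - 8 / (3 * pi)\<bar>)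
           \<le> 1 / (p * (1 - p)) / T + d + \<bar>semicircle_primitive d\<bar> + \<bar>semicircle_primitive T - 4 / 3\<bar>
             + T\<^sup>2 * rate / (d ^ 4 * sqrt (real n))"
proof -
  let ?c = "1 / (p * (1 - p)) / T + d + \<bar>semicircle_primitive d\<bar> + \<bar>semicircle_primitive T - 4 / 3\<bar>"
  let ?I = "\<lambda>w. \<bar>(truncated_energy w T - semicircle_primitive T) - (truncated_energy w d - semicircle_primitive d)\<bar>"
  have "\<bar>kernel_energy n (wigner w) / real n - 8 / (3 * pi)\<bar> \<le> ?c + ?I w" for w
  proof -
    have T0: "T > 0" using d by simp
    \<comment> \<open>Telescope over the points \<open>0\<close>, \<open>d\<close>, \<open>T\<close> and infinity.\<close>
    have "\<bar>pi / 2 * (kernel_energy n (wigner w) / real n) - 4 / 3\<bar> \<le> ?c + ?I w"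
      using truncated_energy_large[OF T0, of w] truncated_energy_small[of d w] d by linarith
    moreover have "pi / 2 * (kernel_energy n (wigner w) / real n) - 4 / 3 =
        pi / 2 * (kernel_energy n (wigner w) / real n - 8 / (3 * pi))"
      by (simp add: field_simps)
    hence "\<bar>pi / 2 * (kernel_energy n (wigner w) / real n) - 4 / 3\<bar> =
        pi / 2 * \<bar>kernel_energy n (wigner w) / real n - 8 / (3 * pi)\<bar>"
      by (simp only: abs_mult) simp
    moreover have "1 * \<bar>kernel_energy n (wigner w) / real n - 8 / (3 * pi)\<bar> \<le>
        pi / 2 * \<bar>kernel_energy n (wigner w) / real n - 8 / (3 * pi)\<bar>"
      using pi_ge_two by (intro mult_right_mono) auto
    ultimately show ?thesis by linarith
  qed
  hence "measure_pmf.expectation edge_pmf (\<lambda>w. \<bar>kernel_energy n (wigner w) / real n - 8 / (3 * pi)\<bar>) \<le>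
      measure_pmf.expectation edge_pmf (\<lambda>w. ?c + ?I w)"
    by (intro expectation_mono_finite finite_set_edge_pmf)
  also have "\<dots> = ?c + measure_pmf.expectation edge_pmf ?I"
    by (simp add: integrable_edge_pmf)
  also have "\<dots> \<le> ?c + T\<^sup>2 * rate / (d ^ 4 * sqrt (real n))"
    by (intro add_left_mono expected_truncated_energy_increment d)
  finally show ?thesis .
qed

end

text \<open>
  The error bound has parts that become small as \<open>T\<close> grows, as \<open>d\<close> shrinks, and for fixed \<open>T\<close> and \<open>d\<close> as \<open>n\<close>
  grows; the parameters are chosen in this order.
\<close>

lemma expected_energy_limit:
  assumes p: "0 < p" "p < 1"
  shows "(\<lambda>n. measure_pmf.expectation (gnp.edge_pmf p n)
            (\<lambda>w. \<bar>kernel_energy n (gnp.wigner p n w) / real n - 8 / (3 * pi)\<bar>)) \<longlonglongrightarrow> 0"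
    (is "?a \<longlonglongrightarrow> 0")
proof (rule LIMSEQ_I)
  fix r :: real assume r: "r > 0"
  have "((\<lambda>T. 1 / (p * (1 - p)) / T + \<bar>semicircle_primitive T - 4 / 3\<bar>) \<longlongrightarrow> 0 + \<bar>4 / 3 - 4 / 3\<bar>) at_top"
    by (intro tendsto_intros semicircle_primitive_at_top) real_asymp
  hence "eventually (\<lambda>T. 1 / (p * (1 - p)) / T + \<bar>semicircle_primitive T - 4 / 3\<bar> < r / 3) at_top"
    using r by (intro order_tendstoD(2)) auto
  hence "eventually (\<lambda>T. 1 / (p * (1 - p)) / T + \<bar>semicircle_primitive T - 4 / 3\<bar> < r / 3 \<and> 1 \<le> T) at_top"
    by (intro eventually_conj eventually_ge_at_top)
  then obtain T where T: "1 / (p * (1 - p)) / T + \<bar>semicircle_primitive T - 4 / 3\<bar> < r / 3" "1 \<le> T"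
    using eventually_happens'[OF trivial_limit_at_top_linorder] by blast
  have "((\<lambda>d. d + \<bar>semicircle_primitive d\<bar>) \<longlongrightarrow> 0 + \<bar>0\<bar>) (at_right 0)"
    by (intro tendsto_intros semicircle_primitive_at_0)
  hence "eventually (\<lambda>d. d + \<bar>semicircle_primitive d\<bar> < r / 3) (at_right 0)"
    using r by (intro order_tendstoD(2)) auto
  moreover have "eventually (\<lambda>d :: real. d \<in> {0<..<1}) (at_right 0)"
    by (rule eventually_at_right_real) simp
  ultimately have "eventually (\<lambda>d. d + \<bar>semicircle_primitive d\<bar> < r / 3 \<and> d \<in> {0<..<1}) (at_right 0)"
    by (rule eventually_conj)
  then obtain d where d: "d + \<bar>semicircle_primitive d\<bar> < r / 3" "0 < d" "d < 1"
    using eventually_happens'[OF trivial_limit_at_right_real] by auto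
  define R where "R = 11 / sqrt (p * (1 - p)) + 2 + 8 / (p * (1 - p))"
  have "(\<lambda>n. (T\<^sup>2 * R / d ^ 4) * (1 / sqrt (real n))) \<longlonglongrightarrow> (T\<^sup>2 * R / d ^ 4) * 0"
    by (intro tendsto_intros) real_asymp
  hence "eventually (\<lambda>n. (T\<^sup>2 * R / d ^ 4) * (1 / sqrt (real n)) < r / 3) sequentially"
    using r by (intro order_tendstoD(2)) auto
  hence "eventually (\<lambda>n. norm (?a n - 0) < r) sequentially"
    using eventually_gt_at_top[of 0]
  proof eventually_elim
    case (elim n)
    interpret gnp p n using p elim by unfold_locales auto
    have "T\<^sup>2 * rate / (d ^ 4 * sqrt (real n)) = (T\<^sup>2 * R / d ^ 4) * (1 / sqrt (real n))"
      by (simp add: rate_def R_def)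
    hence "?a n < r"
      using expected_energy_error[of d T] d T elim by linarith
    moreover have "?a n \<ge> 0" by (intro Bochner_Integration.integral_nonneg) auto
    ultimately show ?case by simp
  qed
  thus "\<exists>no. \<forall>n\<ge>no. norm (?a n - 0) < r"
    by (simp add: eventually_sequentially)
qed

section \<open>Degree fluctuations and the Zagreb matrices\<close>

lemma card_edges_at:
  assumes v: "v \<in> {1..n}"
  shows "card {e \<in> all_edges n. v \<in> e} = n - 1"
proof -
  have "{e \<in> all_edges n. v \<in> e} = (\<lambda>u. {v, u}) ` ({1..n} - {v})"
    using v by (auto simp: all_edges_def card_2_iff image_iff)
  moreover have "inj_on (\<lambda>u. {v, u}) ({1..n} - {v})"
    by (auto simp: inj_on_def doubleton_eq_iff)
  ultimately show ?thesis using v by (simp add: card_image)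
qed

context gnp
begin

definition edges :: "(nat set \<Rightarrow> bool) \<Rightarrow> nat set set" where
  "edges w = {e \<in> all_edges n. w e}"

text \<open>
  Deviations are measured from \<open>n p\<close> rather than from the mean \<open>(n - 1) p\<close>, which costs at most \<open>1\<close> in the
  second moment and keeps the comparison weights simple.
\<close>

definition degdev :: "nat set set \<Rightarrow> nat \<Rightarrow> real" where
  "degdev E i = real (deg E (i + 1)) - real n * p"

lemma deg_eq_sum: "real (deg (edges w) v) = (\<Sum>e\<in>{e \<in> all_edges n. v \<in> e}. of_bool (w e))"
proof -
  have "{e \<in> edges w. v \<in> e} = {e \<in> all_edges n. v \<in> e} \<inter> {e. w e}"
    by (auto simp: edges_def)
  thus ?thesis using finite_all_edges[of n] by (simp add: deg_def of_bool_def sum.If_cases)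
qed

lemma expectation_edge:
  assumes "e \<in> all_edges n"
  shows "measure_pmf.expectation edge_pmf (\<lambda>w. of_bool (w e) :: real) = p"
  unfolding edge_pmf_def using assms p0 p1 finite_all_edges
  by (subst expectation_bernoulli_product_split[of _ e]) auto

text \<open>
  The degree is a sum of \<open>n - 1\<close> coins, each of which changes it by \<open>1\<close>, so Efron-Stein bounds its variance.
\<close>

lemma expectation_degdev_sq:
  assumes i: "i < n"
  shows "measure_pmf.expectation edge_pmf (\<lambda>w. (degdev (edges w) i)\<^sup>2) \<le> real n"
proof -
  let ?A = "{e \<in> all_edges n. i + 1 \<in> e}"
  define d where "d w = (\<Sum>e\<in>?A. of_bool (w e) :: real)" for w
  have card: "card ?A = n - 1" using i by (intro card_edges_at) auto
  have mean: "measure_pmf.expectation edge_pmf d = (real n - 1) * p"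
  proof -
    have "measure_pmf.expectation edge_pmf d = (\<Sum>e\<in>?A. measure_pmf.expectation edge_pmf (\<lambda>w. of_bool (w e)))"
      unfolding d_def by (intro Bochner_Integration.integral_sum integrable_edge_pmf)
    also have "\<dots> = (\<Sum>e\<in>?A. p)"
      by (intro sum.cong refl expectation_edge) auto
    finally show ?thesis using card n0 by (simp add: of_nat_diff)
  qed
  have "measure_pmf.expectation edge_pmf (\<lambda>w. (d w - measure_pmf.expectation edge_pmf d)\<^sup>2) \<le>
          (\<Sum>e\<in>all_edges n. (of_bool (i + 1 \<in> e))\<^sup>2)"
    unfolding edge_pmf_def
  proof (rule efron_stein_bounded_differences)
    fix e and w :: "nat set \<Rightarrow> bool" assume "e \<in> all_edges n"
    have "d (w(e := True)) - d (w(e := False)) = (\<Sum>e'\<in>?A. of_bool (e' = e))"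
      unfolding d_def sum_subtractf[symmetric] by (intro sum.cong) auto
    also have "\<dots> = of_bool (e \<in> ?A)"
      using finite_all_edges[of n] by (simp add: of_bool_def)
    finally show "\<bar>d (w(e := True)) - d (w(e := False))\<bar> \<le> of_bool (i + 1 \<in> e)" by simp
  qed (use p0 p1 finite_all_edges in auto)
  also have "\<dots> = real (card ?A)"
    using finite_all_edges[of n] by (simp add: of_bool_def if_distrib[of "\<lambda>x. x\<^sup>2"] sum.If_cases Int_def cong: if_cong)
  finally have var: "measure_pmf.expectation edge_pmf (\<lambda>w. (d w - (real n - 1) * p)\<^sup>2) \<le> real n - 1"
    using card n0 mean by (simp add: of_nat_diff)
  have deg_d: "real (deg (edges w) (i + 1)) = d w" for w
    unfolding d_def by (rule deg_eq_sum)
  have "(degdev (edges w) i)\<^sup>2 = (d w - (real n - 1) * p)\<^sup>2 - 2 * p * (d w - (real n - 1) * p) + p\<^sup>2" for w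
    unfolding degdev_def deg_d by (simp add: power2_eq_square algebra_simps)
  hence "measure_pmf.expectation edge_pmf (\<lambda>w. (degdev (edges w) i)\<^sup>2) =
      measure_pmf.expectation edge_pmf (\<lambda>w. (d w - (real n - 1) * p)\<^sup>2) + p\<^sup>2"
    using mean by (simp add: integrable_edge_pmf)
  moreover have "p\<^sup>2 \<le> 1" using p0 p1 by (intro power_le_one) auto
  ultimately show ?thesis using var by linarith
qed

text \<open>
  A weighted adjacency matrix \<open>Z\<close> whose weights are close to \<open>c\<close> splits into \<open>c\<close> times the centred adjacency
  matrix, the constant \<open>c p\<close>, and a remainder \<open>F\<close>. Off the diagonal \<open>F\<close> is bounded by the degree deviations; on
  the diagonal it cancels the constant. The factor \<open>L\<close> is the size of the weights relative to \<open>n\<close>.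
\<close>

lemma expected_perturbation:
  fixes g :: "nat set set \<Rightarrow> nat \<Rightarrow> nat \<Rightarrow> real"
  assumes sym: "\<And>E i j. g E i j = g E j i"
    and L: "L \<ge> 0" and c: "0 \<le> c" "c \<le> 2 * L * real n"
    and close: "\<And>w i j. i < n \<Longrightarrow> j < n \<Longrightarrow> \<bar>g (edges w) i j - c\<bar> \<le> L * (\<bar>degdev (edges w) i\<bar> + \<bar>degdev (edges w) j\<bar>)"
  defines "Z \<equiv> \<lambda>w i j. if {i + 1, j + 1} \<in> edges w then g (edges w) i j else 0"
  shows "measure_pmf.expectation edge_pmf (\<lambda>w. \<bar>kernel_energy n (Z w) - c / scale * kernel_energy n (wigner w)\<bar>)
           \<le> 5 * L * (real n)\<^sup>2"
proof -
  define F where "F w i j = Z w i j - c / scale * wigner w i j - c * p" for w i j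
  define S where "S w = (\<Sum>i<n. \<Sum>j<n. (F w i j)\<^sup>2)" for w
  let ?\<delta> = "\<lambda>w i. degdev (edges w) i"
  have symZ: "symmetric_kernel (Z w)" for w
    by (simp add: Z_def symmetric_kernel_def insert_commute sym)
  have dec: "Z w i j = c / scale * wigner w i j + F w i j + c * p" for w i j
    by (simp add: F_def)
  have pert: "\<bar>kernel_energy n (Z w) - c / scale * kernel_energy n (wigner w)\<bar> \<le>
      sqrt (real n) * \<bar>sqrt (S w)\<bar> + 2 * L * (real n)\<^sup>2" for w
  proof -
    have "\<bar>kernel_energy n (Z w) - c / scale * kernel_energy n (wigner w)\<bar> \<le>
        sqrt (real n) * sqrt (S w) + \<bar>c * p\<bar> * real n"
      unfolding S_def using c scale_pos
      by (intro kernel_energy_perturbation[OF symZ symmetric_wigner dec]) auto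
    moreover have "c * p \<le> 2 * L * real n * 1"
      using c p0 p1 by (intro mult_mono) auto
    hence "\<bar>c * p\<bar> * real n \<le> 2 * L * real n * real n"
      using c p0 by (intro mult_right_mono) auto
    moreover have "S w \<ge> 0" unfolding S_def by (intro sum_nonneg) auto
    ultimately show ?thesis by (simp add: power2_eq_square mult_ac)
  qed
  have F: "(F w i j)\<^sup>2 \<le> 2 * L\<^sup>2 * ((?\<delta> w i)\<^sup>2 + (?\<delta> w j)\<^sup>2) + (if i = j then 4 * L\<^sup>2 * (real n)\<^sup>2 else 0)"
    if ij: "i < n" "j < n" for w i j
  proof (cases "i = j")
    case True
    have "F w i j = - (c * p)"
      using True by (simp add: F_def Z_def wigner_def edges_def all_edges_def)
    moreover have "c * p \<le> 2 * L * real n * 1"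
      using c p0 p1 by (intro mult_mono) auto
    hence "(c * p)\<^sup>2 \<le> (2 * L * real n)\<^sup>2"
      using c p0 by (intro power_mono) auto
    ultimately have "(F w i j)\<^sup>2 \<le> 4 * L\<^sup>2 * (real n)\<^sup>2" by (simp add: power_mult_distrib)
    moreover have "0 \<le> 2 * L\<^sup>2 * ((?\<delta> w i)\<^sup>2 + (?\<delta> w j)\<^sup>2)" by simp
    ultimately have "(F w i j)\<^sup>2 \<le> 2 * L\<^sup>2 * ((?\<delta> w i)\<^sup>2 + (?\<delta> w j)\<^sup>2) + 4 * L\<^sup>2 * (real n)\<^sup>2"
      by linarith
    thus ?thesis using True by simp
  next
    case False
    have e: "{i + 1, j + 1} \<in> all_edges n"
      using ij False by (simp only: edge_in_all_edges_iff) simp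
    have "F w i j = of_bool (w {i + 1, j + 1}) * (g (edges w) i j - c)"
      using e scale_pos by (simp add: F_def Z_def wigner_def edges_def field_simps)
    hence "\<bar>F w i j\<bar> \<le> \<bar>g (edges w) i j - c\<bar>" by (simp add: abs_mult)
    also have "\<dots> \<le> L * (\<bar>?\<delta> w i\<bar> + \<bar>?\<delta> w j\<bar>)" by (rule close[OF ij])
    finally have "\<bar>F w i j\<bar>\<^sup>2 \<le> (L * (\<bar>?\<delta> w i\<bar> + \<bar>?\<delta> w j\<bar>))\<^sup>2" by (intro power_mono) auto
    also have "\<dots> = L\<^sup>2 * (\<bar>?\<delta> w i\<bar> + \<bar>?\<delta> w j\<bar>)\<^sup>2" by (simp add: power_mult_distrib)
    also have "\<dots> \<le> L\<^sup>2 * (2 * ((?\<delta> w i)\<^sup>2 + (?\<delta> w j)\<^sup>2))"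
      using sum_squares_bound[of "\<bar>?\<delta> w i\<bar>" "\<bar>?\<delta> w j\<bar>"]
      by (intro mult_left_mono) (simp_all add: power2_sum)
    finally show ?thesis using False by (simp add: algebra_simps)
  qed
  have S: "S w \<le> 4 * L\<^sup>2 * real n * (\<Sum>i<n. (?\<delta> w i)\<^sup>2) + 4 * L\<^sup>2 * real n ^ 3" for w
  proof -
    have "S w \<le> (\<Sum>i<n. \<Sum>j<n. 2 * L\<^sup>2 * ((?\<delta> w i)\<^sup>2 + (?\<delta> w j)\<^sup>2) + (if i = j then 4 * L\<^sup>2 * (real n)\<^sup>2 else 0))"
      unfolding S_def using F by (intro sum_mono) auto
    also have "\<dots> = 4 * L\<^sup>2 * real n * (\<Sum>i<n. (?\<delta> w i)\<^sup>2) + 4 * L\<^sup>2 * real n ^ 3"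
      by (simp add: sum.distrib sum_distrib_left[symmetric] power3_eq_cube power2_eq_square algebra_simps)
    finally show ?thesis .
  qed
  have ES: "measure_pmf.expectation edge_pmf S \<le> (3 * L * real n * sqrt (real n))\<^sup>2"
  proof -
    have "measure_pmf.expectation edge_pmf S \<le>
        measure_pmf.expectation edge_pmf (\<lambda>w. 4 * L\<^sup>2 * real n * (\<Sum>i<n. (?\<delta> w i)\<^sup>2) + 4 * L\<^sup>2 * real n ^ 3)"
      by (intro expectation_mono_finite finite_set_edge_pmf S)
    also have "\<dots> = 4 * L\<^sup>2 * real n * (\<Sum>i<n. measure_pmf.expectation edge_pmf (\<lambda>w. (?\<delta> w i)\<^sup>2)) + 4 * L\<^sup>2 * real n ^ 3"
      by (simp add: integrable_edge_pmf Bochner_Integration.integral_sum)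
    also have "\<dots> \<le> 4 * L\<^sup>2 * real n * (\<Sum>i<n. real n) + 4 * L\<^sup>2 * real n ^ 3"
      by (intro add_right_mono mult_left_mono sum_mono expectation_degdev_sq) auto
    also have "\<dots> = 8 * (L\<^sup>2 * real n ^ 3)"
      by (simp add: power3_eq_cube)
    also have "\<dots> \<le> 9 * (L\<^sup>2 * real n ^ 3)" by simp
    also have "\<dots> = (3 * L * real n * sqrt (real n))\<^sup>2"
      by (simp add: power_mult_distrib power3_eq_cube power2_eq_square)
    finally show ?thesis .
  qed
  have S0: "S w \<ge> 0" for w unfolding S_def by (intro sum_nonneg) auto
  have "measure_pmf.expectation edge_pmf (\<lambda>w. \<bar>sqrt (S w)\<bar>) \<le> sqrt (measure_pmf.expectation edge_pmf (\<lambda>w. (sqrt (S w))\<^sup>2))"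
    by (rule expectation_abs_le_sqrt[OF finite_set_edge_pmf])
  also have "\<dots> = sqrt (measure_pmf.expectation edge_pmf S)" using S0 by simp
  also have "\<dots> \<le> sqrt ((3 * L * real n * sqrt (real n))\<^sup>2)" by (rule real_sqrt_le_mono[OF ES])
  also have "\<dots> = 3 * L * real n * sqrt (real n)" using L by simp
  finally have E: "measure_pmf.expectation edge_pmf (\<lambda>w. \<bar>sqrt (S w)\<bar>) \<le> 3 * L * real n * sqrt (real n)" .
  have "measure_pmf.expectation edge_pmf (\<lambda>w. \<bar>kernel_energy n (Z w) - c / scale * kernel_energy n (wigner w)\<bar>) \<le>
      measure_pmf.expectation edge_pmf (\<lambda>w. sqrt (real n) * \<bar>sqrt (S w)\<bar> + 2 * L * (real n)\<^sup>2)"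
    by (intro expectation_mono_finite finite_set_edge_pmf pert)
  also have "\<dots> = sqrt (real n) * measure_pmf.expectation edge_pmf (\<lambda>w. \<bar>sqrt (S w)\<bar>) + 2 * L * (real n)\<^sup>2"
    by (simp add: integrable_edge_pmf)
  also have "\<dots> \<le> sqrt (real n) * (3 * L * real n * sqrt (real n)) + 2 * L * (real n)\<^sup>2"
    by (intro add_right_mono mult_left_mono E) auto
  also have "\<dots> = 5 * L * (real n)\<^sup>2"
    by (simp add: power2_eq_square)
  finally show ?thesis .
qed

text \<open>
  The centred matrix has energy about \<open>8 n / (3 \<pi>)\<close>, and the factor \<open>c / scale\<close> in front of it supplies the rest
  of the normalisation. The two error terms are the perturbation and the distance to the semicircle moment.
\<close>

lemma prob_energy_ratio_le:
  fixes g :: "nat set set \<Rightarrow> nat \<Rightarrow> nat \<Rightarrow> real"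
  assumes sym: "\<And>E i j. g E i j = g E j i"
    and L: "L > 0" and \<gamma>: "0 < \<gamma>" "\<gamma> \<le> 2"
    and close: "\<And>w i j. i < n \<Longrightarrow> j < n \<Longrightarrow>
        \<bar>g (edges w) i j - \<gamma> * L * real n\<bar> \<le> L * (\<bar>degdev (edges w) i\<bar> + \<bar>degdev (edges w) j\<bar>)"
    and \<epsilon>: "\<epsilon> > 0"
  defines "Z \<equiv> \<lambda>E. mat n n (\<lambda>(i, j). if {i + 1, j + 1} \<in> E then g E i j else 0)"
  shows "measure_pmf.prob (Gnp n p)
           {E. \<bar>energy (Z E) / (\<gamma> * (8 / (3 * pi)) * sqrt (p * (1 - p)) * (L * real n powr (5 / 2))) - 1\<bar> > \<epsilon>}
         \<le> (15 * pi / (8 * \<gamma> * sqrt (p * (1 - p))) / sqrt (real n) +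
             3 * pi / 8 * measure_pmf.expectation edge_pmf (\<lambda>w. \<bar>kernel_energy n (wigner w) / real n - 8 / (3 * pi)\<bar>)) / \<epsilon>"
proof -
  define N where "N = \<gamma> * (8 / (3 * pi)) * sqrt (p * (1 - p)) * (L * real n powr (5 / 2))"
  define c where "c = \<gamma> * L * real n"
  let ?r = "sqrt (p * (1 - p))"
  define K where "K w i j = (if {i + 1, j + 1} \<in> edges w then g (edges w) i j else 0)" for w i j
  define eX where "eX w = kernel_energy n (wigner w)" for w
  define eZ where "eZ w = kernel_energy n (K w)" for w
  have r: "?r > 0" using p0 p1 by simp
  have eZ: "eZ w = energy (Z (edges w))" for w
    by (simp add: eZ_def K_def Z_def kernel_energy_def)
  have "real n powr (5 / 2) = real n powr (2 + 1 / 2)" by simp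
  also have "\<dots> = real n powr 2 * real n powr (1 / 2)" by (rule powr_add)
  also have "\<dots> = (real n)\<^sup>2 * sqrt (real n)"
    using n0 by (simp add: powr_half_sqrt)
  finally have powr: "real n powr (5 / 2) = (real n)\<^sup>2 * sqrt (real n)" .
  have Npos: "N > 0" unfolding N_def using \<gamma> L r n0 by simp
  have N: "N = c / scale * real n * (8 / (3 * pi))"
    unfolding N_def powr c_def scale_def using p0 p1 n0
    by (simp add: real_sqrt_mult power2_eq_square)
  have close': "\<bar>eZ w / N - 1\<bar> \<le> \<bar>eZ w - c / scale * eX w\<bar> / N + 3 * pi / 8 * \<bar>eX w / real n - 8 / (3 * pi)\<bar>" for w
  proof -
    have "c / scale * eX w / N = eX w / real n / (8 / (3 * pi))"
      unfolding N using \<gamma> L n0 scale_pos by (simp add: c_def)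
    hence "eZ w / N - 1 = (eZ w - c / scale * eX w) / N + 3 * pi / 8 * (eX w / real n - 8 / (3 * pi))"
      by (simp add: diff_divide_distrib right_diff_distrib)
    also have "\<bar>\<dots>\<bar> \<le> \<bar>(eZ w - c / scale * eX w) / N\<bar> + \<bar>3 * pi / 8 * (eX w / real n - 8 / (3 * pi))\<bar>"
      by (rule abs_triangle_ineq)
    finally show ?thesis using Npos by (simp add: abs_mult)
  qed
  have pert: "measure_pmf.expectation edge_pmf (\<lambda>w. \<bar>eZ w - c / scale * eX w\<bar>) \<le> 5 * L * (real n)\<^sup>2"
    unfolding eZ_def eX_def K_def
    by (rule expected_perturbation) (use sym L \<gamma> n0 close in \<open>auto simp: c_def\<close>)
  have "measure_pmf.prob (Gnp n p) {E. \<bar>energy (Z E) / N - 1\<bar> > \<epsilon>} =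
      measure_pmf.prob edge_pmf {w. \<bar>eZ w / N - 1\<bar> > \<epsilon>}"
    unfolding eZ by (simp add: Gnp_def edge_pmf_def edges_def vimage_def)
  also have "\<dots> \<le> measure_pmf.expectation edge_pmf (\<lambda>w. \<bar>eZ w / N - 1\<bar>) / \<epsilon>"
    by (rule markov_pmf[OF finite_set_edge_pmf \<epsilon>])
  also have "\<dots> \<le> measure_pmf.expectation edge_pmf
      (\<lambda>w. \<bar>eZ w - c / scale * eX w\<bar> / N + 3 * pi / 8 * \<bar>eX w / real n - 8 / (3 * pi)\<bar>) / \<epsilon>"
    using \<epsilon> by (intro divide_right_mono expectation_mono_finite finite_set_edge_pmf close') auto
  also have "\<dots> = (measure_pmf.expectation edge_pmf (\<lambda>w. \<bar>eZ w - c / scale * eX w\<bar>) / N +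
      3 * pi / 8 * measure_pmf.expectation edge_pmf (\<lambda>w. \<bar>eX w / real n - 8 / (3 * pi)\<bar>)) / \<epsilon>"
    by (simp add: integrable_edge_pmf)
  also have "\<dots> \<le> (5 * L * (real n)\<^sup>2 / N +
      3 * pi / 8 * measure_pmf.expectation edge_pmf (\<lambda>w. \<bar>eX w / real n - 8 / (3 * pi)\<bar>)) / \<epsilon>"
    using \<epsilon> Npos by (intro divide_right_mono add_right_mono pert) auto
  also have "5 * L * (real n)\<^sup>2 / N = 15 * pi / (8 * \<gamma> * ?r) / sqrt (real n)"
    unfolding N_def powr using L n0 by (simp add: field_simps)
  finally show ?thesis unfolding N_def eX_def .
qed

end

lemma prob_energy_ratio_tendsto:
  fixes g :: "nat set set \<Rightarrow> nat \<Rightarrow> nat \<Rightarrow> real" and L :: "nat \<Rightarrow> real"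
  assumes p: "0 < p" "p < 1"
    and sym: "\<And>E i j. g E i j = g E j i"
    and L: "\<And>n. n > 0 \<Longrightarrow> L n > 0" and \<gamma>: "0 < \<gamma>" "\<gamma> \<le> 2"
    and close: "\<And>n w i j. i < n \<Longrightarrow> j < n \<Longrightarrow>
        \<bar>g (gnp.edges n w) i j - \<gamma> * L n * real n\<bar> \<le>
          L n * (\<bar>gnp.degdev p n (gnp.edges n w) i\<bar> + \<bar>gnp.degdev p n (gnp.edges n w) j\<bar>)"
    and \<epsilon>: "\<epsilon> > 0"
  shows "(\<lambda>n. measure_pmf.prob (Gnp n p)
           {E. \<bar>energy (mat n n (\<lambda>(i, j). if {i + 1, j + 1} \<in> E then g E i j else 0)) /
              (\<gamma> * (8 / (3 * pi)) * sqrt (p * (1 - p)) * (L n * real n powr (5 / 2))) - 1\<bar> > \<epsilon>}) \<longlonglongrightarrow> 0"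
proof (rule tendsto_sandwich[OF _ _ tendsto_const])
  let ?b = "\<lambda>n. (15 * pi / (8 * \<gamma> * sqrt (p * (1 - p))) * (1 / sqrt (real n)) +
      3 * pi / 8 * measure_pmf.expectation (gnp.edge_pmf p n)
         (\<lambda>w. \<bar>kernel_energy n (gnp.wigner p n w) / real n - 8 / (3 * pi)\<bar>)) / \<epsilon>"
  have "(\<lambda>n. 1 / sqrt (real n)) \<longlonglongrightarrow> 0" by real_asymp
  hence "?b \<longlonglongrightarrow> (15 * pi / (8 * \<gamma> * sqrt (p * (1 - p))) * 0 + 3 * pi / 8 * 0) / \<epsilon>"
    using \<epsilon> by (intro tendsto_intros expected_energy_limit p) auto
  thus "?b \<longlonglongrightarrow> 0" by simp
  show "eventually (\<lambda>n. measure_pmf.prob (Gnp n p)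
           {E. \<bar>energy (mat n n (\<lambda>(i, j). if {i + 1, j + 1} \<in> E then g E i j else 0)) /
              (\<gamma> * (8 / (3 * pi)) * sqrt (p * (1 - p)) * (L n * real n powr (5 / 2))) - 1\<bar> > \<epsilon>} \<le> ?b n) sequentially"
    using eventually_gt_at_top[of 0]
  proof eventually_elim
    case (elim n)
    interpret gnp p n using p elim by unfold_locales auto
    show ?case
      using prob_energy_ratio_le[of g "L n" \<gamma> \<epsilon>] sym L[OF elim] \<gamma> close \<epsilon> by simp
  qed
qed auto

text \<open>
  The weights \<open>d\<^sub>i + d\<^sub>j\<close> are compared with \<open>2 p n\<close>, so \<open>L = 1\<close>; the weights \<open>d\<^sub>i d\<^sub>j\<close> with \<open>p\<^sup>2 n\<^sup>2\<close>, so \<open>L = n\<close>,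
  which raises the exponent from \<open>5 / 2\<close> to \<open>7 / 2\<close>.
\<close>

theorem corollary5:
  fixes p :: real
  assumes "0 < p" and "p < 1"
  shows "(\<forall>\<epsilon>>0. (\<lambda>n. measure_pmf.prob (Gnp n p)
            {E. \<bar>energy (zagreb1 n E) /
                 (p * (16 / (3 * pi)) * sqrt (p * (1 - p)) * real n powr (5 / 2)) - 1\<bar> > \<epsilon>})
          \<longlonglongrightarrow> 0)
       \<and> (\<forall>\<epsilon>>0. (\<lambda>n. measure_pmf.prob (Gnp n p)
            {E. \<bar>energy (zagreb2 n E) /
                 (p\<^sup>2 * (8 / (3 * pi)) * sqrt (p * (1 - p)) * real n powr (7 / 2)) - 1\<bar> > \<epsilon>})
          \<longlonglongrightarrow> 0)"
proof (intro conjI allI impI)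
  fix \<epsilon> :: real assume \<epsilon>: "\<epsilon> > 0"
  let ?d = "\<lambda>E i. real (deg E (i + 1))"
  have "(\<lambda>n. measure_pmf.prob (Gnp n p)
           {E. \<bar>energy (mat n n (\<lambda>(i, j). if {i + 1, j + 1} \<in> E then ?d E i + ?d E j else 0)) /
              ((2 * p) * (8 / (3 * pi)) * sqrt (p * (1 - p)) * (1 * real n powr (5 / 2))) - 1\<bar> > \<epsilon>}) \<longlonglongrightarrow> 0"
  proof (rule prob_energy_ratio_tendsto[OF assms _ _ _ _ _ \<epsilon>])
    fix n i j :: nat and w assume "i < n" "j < n"
    then interpret gnp p n using assms by unfold_locales auto
    have eq: "(?d (edges w) i + ?d (edges w) j) - 2 * p * 1 * real n = degdev (edges w) i + degdev (edges w) j"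
      by (simp add: degdev_def)
    show "\<bar>(?d (edges w) i + ?d (edges w) j) - 2 * p * 1 * real n\<bar> \<le> 1 * (\<bar>degdev (edges w) i\<bar> + \<bar>degdev (edges w) j\<bar>)"
      unfolding eq by simp
  qed (use assms in auto)
  thus "(\<lambda>n. measure_pmf.prob (Gnp n p)
            {E. \<bar>energy (zagreb1 n E) /
                 (p * (16 / (3 * pi)) * sqrt (p * (1 - p)) * real n powr (5 / 2)) - 1\<bar> > \<epsilon>})
          \<longlonglongrightarrow> 0"
    by (simp add: zagreb1_def mult_ac)
  have "(\<lambda>n. measure_pmf.prob (Gnp n p)
           {E. \<bar>energy (mat n n (\<lambda>(i, j). if {i + 1, j + 1} \<in> E then ?d E i * ?d E j else 0)) /
              (p\<^sup>2 * (8 / (3 * pi)) * sqrt (p * (1 - p)) * (real n * real n powr (5 / 2))) - 1\<bar> > \<epsilon>}) \<longlonglongrightarrow> 0"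
  proof (rule prob_energy_ratio_tendsto[OF assms _ _ _ _ _ \<epsilon>])
    fix n i j :: nat and w assume ij: "i < n" "j < n"
    then interpret gnp p n using assms by unfold_locales auto
    let ?x = "?d (edges w) i" and ?y = "?d (edges w) j"
    have "deg (edges w) (i + 1) \<le> card {e \<in> all_edges n. i + 1 \<in> e}"
      unfolding deg_def edges_def using finite_all_edges[of n] by (intro card_mono) auto
    also have "\<dots> \<le> n" using card_edges_at[of "i + 1" n] ij by simp
    finally have x: "?x \<le> real n" by simp
    have "?x * ?y - p\<^sup>2 * real n * real n = ?x * degdev (edges w) j + real n * p * degdev (edges w) i"
      by (simp add: degdev_def power2_eq_square algebra_simps)
    hence "\<bar>?x * ?y - p\<^sup>2 * real n * real n\<bar> \<le> ?x * \<bar>degdev (edges w) j\<bar> + real n * p * \<bar>degdev (edges w) i\<bar>"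
      using abs_triangle_ineq[of "?x * degdev (edges w) j" "real n * p * degdev (edges w) i"] assms
      by (simp add: abs_mult)
    also have "\<dots> \<le> real n * \<bar>degdev (edges w) j\<bar> + real n * 1 * \<bar>degdev (edges w) i\<bar>"
      using x assms by (intro add_mono mult_right_mono mult_left_mono) auto
    finally show "\<bar>?x * ?y - p\<^sup>2 * real n * real n\<bar> \<le> real n * (\<bar>degdev (edges w) i\<bar> + \<bar>degdev (edges w) j\<bar>)"
      by (simp add: algebra_simps)
  next
    have "p\<^sup>2 \<le> 1" using assms by (intro power_le_one) auto
    thus "p\<^sup>2 \<le> 2" by simp
  qed (use assms in \<open>auto simp: mult.commute\<close>)
  moreover have "real n * real n powr (5 / 2) = real n powr (7 / 2)" for n
    using powr_mult_base[of "real n" "5 / 2"] by simp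
  ultimately show "(\<lambda>n. measure_pmf.prob (Gnp n p)
            {E. \<bar>energy (zagreb2 n E) /
                 (p\<^sup>2 * (8 / (3 * pi)) * sqrt (p * (1 - p)) * real n powr (7 / 2)) - 1\<bar> > \<epsilon>})
          \<longlonglongrightarrow> 0"
    by (simp add: zagreb2_def)
qed

end
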